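(* Let $M$ be a $4\times 2$ integer matrix, and let $X=M^{\mathrm{SACG}}$ be the associated standardized abelian Cayley graph. Suppose that $X$ is nonbipartite and has no loops, and that $M$ has no zero rows. Then $\chi(X)=4$ if there exist a $4\times 4$ signed permutation matrix $P$ and a $2\times 2$ unimodular matrix $U$ such that $$PMU=\begin{pmatrix} 1 & a\\ 1 & b\\ 1 & c\\ 0 & 1\end{pmatrix}$$ for some integers $a,b,c$ with $3\mid a+b+c$, and $\chi(X)=3$ otherwise. (In particular, $\chi(X)=4$ if and only if such $P$, $U$, $a,b,c$ exist.)
   Context: For a group $G$ (here abelian, written additively) with a symmetric subset $S$ (i.e. $-x\in S$ whenever $x\in S$), the Cayley graph $\mathrm{Cay}(G,S)$ is the graph with vertex set $G$ in which $x$ and $y$ are adjacent if and only if $y-x\in S$. Standardized abelian Cayley graph (SACG): given an $m\times r$ integer matrix $M$, let $H$ be the subgroup of $\mathbb{Z}^m$ generated by the columns of $M$, let $G=\mathbb{Z}^m/H$, and let $S=\{H\pm e_1,\dots,H\pm e_m\}$, where $e_i\in\mathbb{Z}^m$ is the column vector with $1$ in the $i$th position and $0$ elsewhere. Then $M^{\mathrm{SACG}}$ denotes $\mathrm{Cay}(G,S)$. A loop in a graph is an edge from a vertex to itself (so $M^{\mathrm{SACG}}$ has a loop exactly when $0\in S$, and a graph with a loop has no proper coloring). A proper coloring assigns a color to each vertex so that adjacent vertices receive different colors; $\chi(X)$ is the smallest number of colors in a proper coloring of $X$. A graph here is bipartite if and only if it has chromatic number $2$. A row of a matrix is a zero row if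 every entry in it is $0$. A square integer matrix is a signed permutation matrix if each row and each column has exactly one nonzero entry, which is $\pm 1$. A unimodular matrix is a square integer matrix with determinant $\pm 1$. *)

theory Defs
  imports
    "HOL-Analysis.Analysis"
    "HOL-Algebra.Generated_Groups"
    "HOL-Library.Extended_Nat"
    "Graph_Theory.Pair_Digraph"
begin

section \<open>Graphs and colorings\<close>

text \<open>
  An undirected graph, possibly infinite and possibly with loops, is a \<^typ>\<open>'v pair_pre_digraph\<close>
  whose arc relation is symmetric.
\<close>

definition has_loop :: "'v pair_pre_digraph \<Rightarrow> bool" where
  "has_loop X \<longleftrightarrow> (\<exists>v. (v, v) \<in> parcs X)"

definition proper_coloring :: "'v pair_pre_digraph \<Rightarrow> ('v \<Rightarrow> 'c) \<Rightarrow> bool" where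
  "proper_coloring X f \<longleftrightarrow> (\<forall>(u, v) \<in> parcs X. f u \<noteq> f v)"

text \<open>The value is \<^term>\<open>\<infinity>\<close> if there is no proper coloring with finitely many colors.\<close>

definition chromatic_number :: "'v pair_pre_digraph \<Rightarrow> enat" where
  "chromatic_number X =
     Inf {enat k | k. \<exists>f :: 'v \<Rightarrow> nat. f ` pverts X \<subseteq> {..<k} \<and> proper_coloring X f}"

definition bipartite :: "'v pair_pre_digraph \<Rightarrow> bool" where
  "bipartite X \<longleftrightarrow> chromatic_number X = 2"


section \<open>Cayley graphs\<close>

text \<open>In additive notation, the adjacency condition reads \<open>y - x \<in> S\<close>.\<close>

definition Cay :: "('g, 'e) monoid_scheme \<Rightarrow> 'g set \<Rightarrow> 'g pair_pre_digraph" where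
  "Cay G S = \<lparr> pverts = carrier G,
               parcs = {(x, y). x \<in> carrier G \<and> y \<in> carrier G \<and> y \<otimes>\<^bsub>G\<^esub> inv\<^bsub>G\<^esub> x \<in> S} \<rparr>"

definition int_lattice :: "(int ^ 'm) monoid" where
  "int_lattice = \<lparr> carrier = UNIV, mult = (+), one = 0 \<rparr>"

definition column_subgroup :: "int ^ 'r ^ 'm \<Rightarrow> (int ^ 'm) set" where
  "column_subgroup M = generate int_lattice (columns M)"

definition SACG_group :: "int ^ 'r ^ 'm \<Rightarrow> (int ^ 'm) set monoid" where
  "SACG_group M = int_lattice Mod column_subgroup M"

definition SACG_gens :: "int ^ 'r ^ 'm \<Rightarrow> (int ^ 'm) set set" where
  "SACG_gens M =
     (\<Union>i. {column_subgroup M #>\<^bsub>int_lattice\<^esub> axis i 1,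
           column_subgroup M #>\<^bsub>int_lattice\<^esub> (- axis i 1)})"

definition SACG :: "int ^ 'r ^ 'm \<Rightarrow> (int ^ 'm) set pair_pre_digraph" where
  "SACG M = Cay (SACG_group M) (SACG_gens M)"


section \<open>Integer matrices\<close>

definition signed_permutation_matrix :: "int ^ 'n ^ 'n \<Rightarrow> bool" where
  "signed_permutation_matrix P \<longleftrightarrow>
     (\<forall>i. \<exists>!j. P $ i $ j \<noteq> 0) \<and> (\<forall>j. \<exists>!i. P $ i $ j \<noteq> 0) \<and>
     (\<forall>i j. P $ i $ j \<noteq> 0 \<longrightarrow> P $ i $ j = 1 \<or> P $ i $ j = - 1)"

definition unimodular :: "int ^ 'n ^ 'n \<Rightarrow> bool" where
  "unimodular U \<longleftrightarrow> det U = 1 \<or> det U = - 1"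

end

theory Submission
  imports Defs
begin

text \<open>
  A point \<open>t \<in> [1/3, 2/3]\<^sup>4\<close> that pairs integrally with both columns of \<open>M\<close> gives the 3-coloring
  \<open>x \<mapsto> \<lfloor>3 {t \<cdot> x}\<rfloor>\<close>. Writing \<open>t = 1/2 + s/6\<close> for a basis \<open>x, y\<close> of the column lattice with odd,
  respectively even, coordinate sum, one needs \<open>s \<in> [-1, 1]\<^sup>4\<close> with \<open>s \<cdot> x = 3\<close> and \<open>s \<cdot> y \<in> 6\<int>\<close>.
  Choose \<open>x\<close>, and then \<open>y\<close>, of minimal 1-norm. Reducedness bounds \<open>\<parallel>x + u y\<parallel>\<close> below by both \<open>\<parallel>x\<parallel> / 2\<close>
  and \<open>\<parallel>x\<parallel> - \<parallel>y\<parallel> / 2\<close> for all real \<open>u\<close>; if this is at least 3, a separating hyperplane argument for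
  the zonotope \<open>{(s \<cdot> x, s \<cdot> y)}\<close> even gives \<open>s \<cdot> y = 0\<close>. The odd norm \<open>\<parallel>x\<parallel> = 1\<close> would be a loop, so
  only \<open>\<parallel>x\<parallel> \<in> {3, 5}\<close> is left. Up to signs and order there are nine such \<open>x\<close>, and vertices of the
  slice \<open>s \<cdot> x = 3\<close> settle all of them except \<open>x = (1, 1, 1, 0)\<close> with \<open>y\<^sub>4 = \<plusminus>1\<close> and
  \<open>3 | y\<^sub>1 + y\<^sub>2 + y\<^sub>3\<close>, which is the exceptional matrix. For that matrix the first column makes triangles,
  which determine a 3-coloring up to renaming and make the fourth generator a period of it;
  a \<open>t \<in> [1/4, 3/4]\<^sup>4\<close> still gives a 4-coloring.
\<close>

section \<open>Colorings of standardized abelian Cayley graphs\<close>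

text \<open>The infimum is taken in the well-ordered type \<open>enat\<close>, so it is attained
  once the set of palette sizes is nonempty; a finite bound excludes the empty set, whose infimum is
  infinite. A smaller palette is padded to size \<open>k\<close>.\<close>

lemma chromatic_number_le_iff:
  "chromatic_number X \<le> enat k \<longleftrightarrow>
     (\<exists>f :: 'v \<Rightarrow> nat. f ` pverts X \<subseteq> {..<k} \<and> proper_coloring X f)"
  for X :: "'v pair_pre_digraph"
proof
  let ?A = "{enat k | k. \<exists>f :: 'v \<Rightarrow> nat. f ` pverts X \<subseteq> {..<k} \<and> proper_coloring X f}"
  assume le: "chromatic_number X \<le> enat k"
  have "?A \<noteq> {}"
  proof
    assume "?A = {}"
    then have "chromatic_number X = \<infinity>"
      unfolding chromatic_number_def by (simp only: Inf_enat_def) simp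
    then show False using le by simp
  qed
  then have "Inf ?A \<in> ?A"
    by (meson ex_in_conv wellorder_InfI)
  then obtain j where j: "Inf ?A = enat j"
    and ex: "\<exists>f :: 'v \<Rightarrow> nat. f ` pverts X \<subseteq> {..<j} \<and> proper_coloring X f"
    by blast
  obtain f :: "'v \<Rightarrow> nat" where f: "f ` pverts X \<subseteq> {..<j}" "proper_coloring X f"
    using ex by blast
  have "j \<le> k"
    using le j unfolding chromatic_number_def by simp
  then have "f ` pverts X \<subseteq> {..<k}"
    using f(1) by fastforce
  then show "\<exists>f :: 'v \<Rightarrow> nat. f ` pverts X \<subseteq> {..<k} \<and> proper_coloring X f"
    using f(2) by blast
next
  assume "\<exists>f :: 'v \<Rightarrow> nat. f ` pverts X \<subseteq> {..<k} \<and> proper_coloring X f"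
  then show "chromatic_number X \<le> enat k"
    unfolding chromatic_number_def by (intro Inf_lower) blast
qed

section \<open>The integer lattice and the subgroup spanned by the columns\<close>

lemma int_lattice_simps [simp]:
  "carrier int_lattice = UNIV" "x \<otimes>\<^bsub>int_lattice\<^esub> y = x + y" "\<one>\<^bsub>int_lattice\<^esub> = 0"
  by (simp_all add: int_lattice_def)

lemma comm_group_int_lattice: "comm_group (int_lattice :: (int ^ 'm) monoid)"
proof (rule comm_groupI)
  fix x :: "int ^ 'm"
  show "\<exists>y\<in>carrier int_lattice. y \<otimes>\<^bsub>int_lattice\<^esub> x = \<one>\<^bsub>int_lattice\<^esub>"
    by (rule bexI[of _ "- x"]) auto
qed (auto simp: algebra_simps)

interpretation int_lattice: comm_group "int_lattice :: (int ^ 'm) monoid"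
  by (rule comm_group_int_lattice)

lemma inv_int_lattice [simp]: "inv\<^bsub>int_lattice\<^esub> x = - x"
  by (rule int_lattice.inv_equality) auto

lemma subgroup_column_subgroup: "subgroup (column_subgroup M) int_lattice"
  unfolding column_subgroup_def by (rule int_lattice.generate_is_subgroup) simp

lemma normal_column_subgroup: "column_subgroup M \<lhd> int_lattice"
  using subgroup_column_subgroup by (rule int_lattice.subgroup_imp_normal)

lemma column_subgroup_closed:
  shows "0 \<in> column_subgroup M"
    and "x \<in> column_subgroup M \<Longrightarrow> y \<in> column_subgroup M \<Longrightarrow> x + y \<in> column_subgroup M"
    and "x \<in> column_subgroup M \<Longrightarrow> - x \<in> column_subgroup M"
    and "column j M \<in> column_subgroup M"
proof -
  note H = subgroup_column_subgroup[of M]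
  show "0 \<in> column_subgroup M"
    using subgroup.one_closed[OF H] by simp
  show "x + y \<in> column_subgroup M" if "x \<in> column_subgroup M" "y \<in> column_subgroup M"
    using subgroup.m_closed[OF H that] by simp
  show "- x \<in> column_subgroup M" if "x \<in> column_subgroup M"
    using subgroup.m_inv_closed[OF H that] by simp
  show "column j M \<in> column_subgroup M"
    unfolding column_subgroup_def by (rule generate.incl) (auto simp: columns_def)
qed

text \<open>Stated for a bare set with closure properties, so that it applies both to the column
  subgroup and to the set of periods of a coloring.\<close>

lemma int_multiple_closed:
  fixes S :: "(int ^ 'm) set"
  assumes "0 \<in> S" "\<And>x y. x \<in> S \<Longrightarrow> y \<in> S \<Longrightarrow> x + y \<in> S" "\<And>x. x \<in> S \<Longrightarrow> - x \<in> S" and "x \<in> S"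
  shows "k *s x \<in> S"
proof (induction k rule: int_induct[where k = 0])
  case base
  then show ?case using assms(1) by simp
next
  case (step1 i)
  have "(i + 1) *s x = i *s x + x"
    by (simp add: vec_eq_iff algebra_simps)
  then show ?case using step1 assms by simp
next
  case (step2 i)
  have "(i - 1) *s x = i *s x + - x"
    by (simp add: vec_eq_iff algebra_simps)
  then show ?case using step2 assms by metis
qed

lemma column_subgroup_scale: "x \<in> column_subgroup M \<Longrightarrow> k *s x \<in> column_subgroup M"
  using column_subgroup_closed by (intro int_multiple_closed) auto

section \<open>The graph described through integer vectors instead of cosets\<close>

abbreviation SACG_vertex :: "int ^ 'r ^ 'm \<Rightarrow> int ^ 'm \<Rightarrow> (int ^ 'm) set" where
  "SACG_vertex M x \<equiv> column_subgroup M #>\<^bsub>int_lattice\<^esub> x"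

lemma SACG_vertex_eq_iff: "SACG_vertex M x = SACG_vertex M y \<longleftrightarrow> x - y \<in> column_subgroup M"
proof
  assume eq: "SACG_vertex M x = SACG_vertex M y"
  have "x \<in> SACG_vertex M x"
    using int_lattice.rcos_self[OF _ subgroup_column_subgroup] by simp
  then obtain h where "h \<in> column_subgroup M" "x = h + y"
    unfolding eq by (auto simp: r_coset_def)
  then show "x - y \<in> column_subgroup M" by simp
next
  assume "x - y \<in> column_subgroup M"
  then have "x \<in> SACG_vertex M y"
    by (auto simp: r_coset_def intro!: bexI[of _ "x - y"])
  then show "SACG_vertex M x = SACG_vertex M y"
    using int_lattice.repr_independence[OF _ _ subgroup_column_subgroup, of x M y] by simp
qed

lemma pverts_SACG: "pverts (SACG M) = range (SACG_vertex M)"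
  by (auto simp: SACG_def Cay_def SACG_group_def FactGroup_def RCOSETS_def)

text \<open>Every vertex is the coset of some vector and the group operations act on
  representatives, so adjacency depends only on the coset of \<open>y - x\<close>; the endpoint can
  then be rewritten as \<open>x\<close> plus a signed unit vector.\<close>

lemma parcs_SACG:
  "parcs (SACG M) =
     {(SACG_vertex M x, SACG_vertex M (x + e)) | x e. \<exists>i. e = axis i 1 \<or> e = - axis i 1}"
proof -
  have arc: "(SACG_vertex M x, SACG_vertex M y) \<in> parcs (SACG M) \<longleftrightarrow>
      SACG_vertex M (y - x) \<in> SACG_gens M" for x y
  proof -
    have "inv\<^bsub>SACG_group M\<^esub> (SACG_vertex M x) = SACG_vertex M (- x)"
      unfolding SACG_group_def
      using normal.inv_FactGroup[OF normal_column_subgroup, of "SACG_vertex M x" M]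
        normal.rcos_inv[OF normal_column_subgroup, of x M]
      by (auto simp: FactGroup_def RCOSETS_def)
    moreover have "SACG_vertex M y \<otimes>\<^bsub>SACG_group M\<^esub> SACG_vertex M (- x) = SACG_vertex M (y - x)"
      using normal.rcos_sum[OF normal_column_subgroup, of y "- x" M]
      by (simp add: SACG_group_def FactGroup_def)
    ultimately show ?thesis
      by (auto simp: SACG_def Cay_def SACG_group_def FactGroup_def RCOSETS_def)
  qed
  have verts: "u \<in> range (SACG_vertex M) \<and> v \<in> range (SACG_vertex M)"
    if "(u, v) \<in> parcs (SACG M)" for u v
    using that by (auto simp: SACG_def Cay_def SACG_group_def FactGroup_def RCOSETS_def)
  show ?thesis (is "_ = ?R")
  proof (rule equalityI; rule subsetI)
    fix p assume p: "p \<in> parcs (SACG M)"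
    obtain x y where xy: "p = (SACG_vertex M x, SACG_vertex M y)"
      using verts p by (metis prod.collapse rangeE)
    then have "SACG_vertex M (y - x) \<in> SACG_gens M"
      using arc p by blast
    then obtain e i where e: "e = axis i 1 \<or> e = - axis i 1"
      and "SACG_vertex M (y - x) = SACG_vertex M e"
      unfolding SACG_gens_def by blast
    then have "SACG_vertex M y = SACG_vertex M (x + e)"
      by (simp add: SACG_vertex_eq_iff algebra_simps)
    then show "p \<in> ?R" using e xy by blast
  next
    fix p assume "p \<in> ?R"
    then obtain x e i where p: "p = (SACG_vertex M x, SACG_vertex M (x + e))"
      and e: "e = axis i 1 \<or> e = - axis i 1"
      by blast
    have "SACG_vertex M e \<in> SACG_gens M"
      using e unfolding SACG_gens_def by blast
    then show "p \<in> parcs (SACG M)"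
      unfolding p arc by simp
  qed
qed

text \<open>A negative step from \<open>x\<close> is a positive step from
  \<open>x - axis i 1\<close> read backwards, so positive steps suffice.\<close>

lemma proper_coloring_SACG_iff:
  "proper_coloring (SACG M) f \<longleftrightarrow>
     (\<forall>x i. f (SACG_vertex M x) \<noteq> f (SACG_vertex M (x + axis i 1)))" (is "_ \<longleftrightarrow> ?R")
proof
  assume "proper_coloring (SACG M) f"
  then show ?R
    unfolding proper_coloring_def parcs_SACG by fast
next
  assume R: ?R
  have "f (SACG_vertex M x) \<noteq> f (SACG_vertex M (x - axis i 1))" for x i
    using R[rule_format, of "x - axis i 1" i] by simp
  then show "proper_coloring (SACG M) f"
    using R unfolding proper_coloring_def parcs_SACG by auto
qed

lemma has_loop_SACG:
  assumes "axis i 1 \<in> column_subgroup M \<or> - axis i 1 \<in> column_subgroup M"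
  shows "has_loop (SACG M)"
proof -
  have "axis i 1 \<in> column_subgroup M"
    using assms column_subgroup_closed(3) by fastforce
  then have "SACG_vertex M 0 = SACG_vertex M (0 + axis i 1)"
    by (simp add: SACG_vertex_eq_iff column_subgroup_closed(3))
  then show ?thesis
    unfolding has_loop_def parcs_SACG
    by (smt (verit) mem_Collect_eq)
qed

section \<open>Linear forms modulo 1 and the colorings they give\<close>

definition character :: "('m \<Rightarrow> real) \<Rightarrow> int ^ 'm::finite \<Rightarrow> real" where
  "character t x = (\<Sum>i\<in>UNIV. t i * of_int (x $ i))"

lemma character_simps:
  "character t 0 = 0"
  "character t (x + y) = character t x + character t y"
  "character t (x - y) = character t x - character t y"
  "character t (- x) = - character t x"
  "character t (k *s x) = of_int k * character t x"
  "character t (axis i 1) = t i"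
  by (simp_all add: character_def sum.distrib sum_subtractf sum_negf sum_distrib_left
      algebra_simps axis_def if_distrib cong: if_cong)

lemma character_column_subgroup:
  assumes "\<And>j. character t (column j M) \<in> \<int>" "h \<in> column_subgroup M"
  shows "character t h \<in> \<int>"
  using assms(2) unfolding column_subgroup_def
proof (induction rule: generate.induct)
  case (incl h)
  then show ?case using assms(1) by (auto simp: columns_def)
next
  case (inv h)
  then show ?case using assms(1) by (auto simp: columns_def character_simps)
qed (auto simp: character_simps)

text \<open>Cut the circle of reals modulo 1 into \<open>n\<close> half-open arcs of length
  \<open>1 / n\<close>. Two points of one arc differ by less than \<open>1 / n\<close> modulo 1,
  whereas \<open>t\<close> has distance at least \<open>1 / n\<close> from every integer.\<close>

lemma floor_frac_shift_neq:
  fixes a t :: real and n :: nat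
  assumes n: "n > 0" and t: "1 / n \<le> t" "t \<le> 1 - 1 / n"
  shows "\<lfloor>n * frac (a + t)\<rfloor> \<noteq> \<lfloor>n * frac a\<rfloor>"
proof
  assume eq: "\<lfloor>n * frac (a + t)\<rfloor> = \<lfloor>n * frac a\<rfloor>"
  define m where "m = \<lfloor>a\<rfloor> - \<lfloor>a + t\<rfloor>"
  have m: "frac (a + t) - frac a = t + of_int m"
    by (simp add: frac_def m_def)
  have "\<bar>n * frac (a + t) - n * frac a\<bar> < 1"
    using eq by linarith
  then have "\<bar>n * (t + of_int m)\<bar> < 1"
    unfolding m[symmetric] by (simp add: algebra_simps)
  then have "n * \<bar>t + of_int m\<bar> < 1"
    by (simp add: abs_mult)
  then have lt: "\<bar>t + of_int m\<bar> < 1 / n"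
    using n by (simp add: field_simps)
  have "m \<ge> 0 \<or> m \<le> -1" by linarith
  then show False
  proof
    assume "m \<ge> 0"
    then have "real_of_int m \<ge> 0" by simp
    then show False using lt t by linarith
  next
    assume "m \<le> -1"
    then have "real_of_int m \<le> -1" by linarith
    then show False using lt t by linarith
  qed
qed

text \<open>Being integral on the columns, \<open>character t\<close> descends modulo 1 to the
  quotient group. A generator turns the circle by \<open>t i\<close> or its negative, hence always
  leaves the current arc of length \<open>1 / n\<close>; the arcs serve as colors.\<close>

lemma chromatic_number_le_by_character:
  assumes n: "n > 0"
    and t: "\<And>i. 1 / real n \<le> t i" "\<And>i. t i \<le> 1 - 1 / real n"
    and M: "\<And>j. character t (column j M) \<in> \<int>"
  shows "chromatic_number (SACG M) \<le> enat n"
proof -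
  define g where "g x = nat \<lfloor>n * frac (character t x)\<rfloor>" for x
  \<comment> \<open>The choice of representative is harmless, because \<open>g\<close> is constant
    on cosets.\<close>
  define f where "f A = g (SOME x. A = SACG_vertex M x)" for A
  have g_less: "g x < n" for x
  proof -
    have "n * frac (character t x) < n"
      using n frac_lt_1[of "character t x"] by simp
    then show ?thesis
      unfolding g_def using n by (simp add: nat_less_iff floor_less_iff)
  qed
  have f: "f (SACG_vertex M x) = g x" for x
  proof -
    define z where "z = (SOME z. SACG_vertex M x = SACG_vertex M z)"
    have "SACG_vertex M x = SACG_vertex M z"
      unfolding z_def by (rule someI[of _ x]) simp
    then have "character t (x - z) \<in> \<int>"
      using character_column_subgroup[OF M] by (simp add: SACG_vertex_eq_iff)
    then obtain k where "character t x = character t z + of_int k"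
      by (metis Ints_cases add_diff_cancel_left' character_simps(3) diff_add_cancel add.commute)
    then have "g x = g z"
      by (simp add: g_def frac_def)
    then show ?thesis
      by (simp add: f_def z_def)
  qed
  have "g x \<noteq> g (x + axis i 1)" for x i
  proof -
    have "\<lfloor>n * frac (character t x + t i)\<rfloor> \<noteq> \<lfloor>n * frac (character t x)\<rfloor>"
      by (rule floor_frac_shift_neq) (use n t in auto)
    then show ?thesis
      unfolding g_def by (simp add: character_simps eq_nat_nat_iff)
  qed
  then have "proper_coloring (SACG M) f"
    unfolding proper_coloring_SACG_iff f by blast
  moreover have "f ` pverts (SACG M) \<subseteq> {..<n}"
    using f g_less by (auto simp: pverts_SACG)
  ultimately show ?thesis
    unfolding chromatic_number_le_iff by blast
qed

lemma chromatic_number_SACG_ge_2: "2 \<le> chromatic_number (SACG M)"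
proof (rule ccontr)
  assume "\<not> 2 \<le> chromatic_number (SACG M)"
  then have "chromatic_number (SACG M) \<le> enat 1"
    by (cases "chromatic_number (SACG M)") (auto simp: numeral_eq_enat)
  then obtain f :: "_ \<Rightarrow> nat" where f: "f ` pverts (SACG M) \<subseteq> {..<1}" "proper_coloring (SACG M) f"
    unfolding chromatic_number_le_iff by blast
  have "f (SACG_vertex M x) = 0" for x
    using f(1) by (auto simp: pverts_SACG)
  then show False
    using f(2) unfolding proper_coloring_SACG_iff by simp
qed

text \<open>The parity of the coordinate sum is a 2-coloring; it comes from the character with all
  coordinates \<open>1 / 2\<close>.\<close>

lemma bipartite_SACG:
  assumes "\<And>j. even (\<Sum>i\<in>UNIV. column j M $ i)"
  shows "bipartite (SACG M)"
proof -
  have "character (\<lambda>_. 1 / 2) (column j M) \<in> \<int>" for j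
  proof -
    obtain k where "(\<Sum>i\<in>UNIV. column j M $ i) = 2 * k"
      using assms by blast
    then have "real_of_int (\<Sum>i\<in>UNIV. column j M $ i) = of_int (2 * k)"
      by (rule arg_cong)
    then show ?thesis
      by (simp add: character_def flip: sum_divide_distrib)
  qed
  then have "chromatic_number (SACG M) \<le> enat 2"
    by (intro chromatic_number_le_by_character[where t = "\<lambda>_. 1 / 2"]) auto
  then show ?thesis
    unfolding bipartite_def using chromatic_number_SACG_ge_2[of M]
    by (simp add: numeral_eq_enat)
qed

section \<open>Slices of the cube\<close>

text \<open>In the application the first tuple holds the absolute values of the odd basis vector in
  descending order, and the second holds the even basis vector with matching order and signs. A
  multiple of 6 among the values \<open>v\<close> yields a 3-coloring.\<close>

definition slice :: "int \<times> int \<times> int \<times> int \<Rightarrow> int \<times> int \<times> int \<times> int \<Rightarrow> real \<Rightarrow> bool" where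
  "slice = (\<lambda>(a1 :: int, a2 :: int, a3 :: int, a4 :: int) (b1 :: int, b2 :: int, b3 :: int, b4 :: int) v.
     \<exists>s1 s2 s3 s4 :: real.
     \<bar>s1\<bar> \<le> 1 \<and> \<bar>s2\<bar> \<le> 1 \<and> \<bar>s3\<bar> \<le> 1 \<and> \<bar>s4\<bar> \<le> 1 \<and>
     s1 * a1 + s2 * a2 + s3 * a3 + s4 * a4 = 3 \<and>
     s1 * b1 + s2 * b2 + s3 * b3 + s4 * b4 = v)"

lemma sliceI:
  fixes s1 s2 s3 s4 v :: real and a1 a2 a3 a4 b1 b2 b3 b4 :: int
  assumes "\<bar>s1\<bar> \<le> 1" "\<bar>s2\<bar> \<le> 1" "\<bar>s3\<bar> \<le> 1" "\<bar>s4\<bar> \<le> 1"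
    and "s1 * a1 + s2 * a2 + s3 * a3 + s4 * a4 = 3"
    and "s1 * b1 + s2 * b2 + s3 * b3 + s4 * b4 = v"
  shows "slice (a1, a2, a3, a4) (b1, b2, b3, b4) v"
  using assms unfolding slice_def prod.case by blast

lemma sliceE:
  fixes v :: real and a1 a2 a3 a4 b1 b2 b3 b4 :: int
  assumes "slice (a1, a2, a3, a4) (b1, b2, b3, b4) v"
  obtains s1 s2 s3 s4 :: real where "\<bar>s1\<bar> \<le> 1" "\<bar>s2\<bar> \<le> 1" "\<bar>s3\<bar> \<le> 1" "\<bar>s4\<bar> \<le> 1"
    and "s1 * a1 + s2 * a2 + s3 * a3 + s4 * a4 = 3"
    and "s1 * b1 + s2 * b2 + s3 * b3 + s4 * b4 = v"
  using assms unfolding slice_def prod.case by (elim exE conjE)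

text \<open>The admissible \<open>s\<close> form a convex set, so a linear form takes an interval of
  values on it.\<close>

lemma slice_convex:
  fixes u v w :: real
  assumes "slice a b u" "slice a b w" "u \<le> v" "v \<le> w"
  shows "slice a b v"
proof (cases "u = w")
  case True
  then show ?thesis using assms by simp
next
  case False
  obtain a1 a2 a3 a4 b1 b2 b3 b4 where ab: "a = (a1, a2, a3, a4)" "b = (b1, b2, b3, b4)"
    by (cases a, cases b)
  from assms(1) obtain s1 s2 s3 s4 :: real where
    s: "\<bar>s1\<bar> \<le> 1" "\<bar>s2\<bar> \<le> 1" "\<bar>s3\<bar> \<le> 1" "\<bar>s4\<bar> \<le> 1"
    and sa: "s1 * a1 + s2 * a2 + s3 * a3 + s4 * a4 = 3"
    and sb: "s1 * b1 + s2 * b2 + s3 * b3 + s4 * b4 = u"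
    unfolding slice_def ab by auto
  from assms(2) obtain r1 r2 r3 r4 :: real where
    r: "\<bar>r1\<bar> \<le> 1" "\<bar>r2\<bar> \<le> 1" "\<bar>r3\<bar> \<le> 1" "\<bar>r4\<bar> \<le> 1"
    and ra: "r1 * a1 + r2 * a2 + r3 * a3 + r4 * a4 = 3"
    and rb: "r1 * b1 + r2 * b2 + r3 * b3 + r4 * b4 = w"
    unfolding slice_def ab by auto
  define k where "k = (v - u) / (w - u)"
  have k: "0 \<le> k" "k \<le> 1" "u + k * (w - u) = v"
    using assms False by (auto simp: k_def field_simps)
  have conv: "\<bar>p + k * (q - p)\<bar> \<le> 1" if "\<bar>p\<bar> \<le> 1" "\<bar>q\<bar> \<le> 1" for p q :: real
  proof -
    have "\<bar>(1 - k) * p + k * q\<bar> \<le> (1 - k) * \<bar>p\<bar> + k * \<bar>q\<bar>"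
      using k by (intro order_trans[OF abs_triangle_ineq]) (simp add: abs_mult)
    also have "\<dots> \<le> (1 - k) * 1 + k * 1"
      using k that by (intro add_mono mult_left_mono) auto
    finally show ?thesis by (simp add: algebra_simps)
  qed
  show ?thesis
    unfolding ab
  proof (rule sliceI[OF conv[OF s(1) r(1)] conv[OF s(2) r(2)] conv[OF s(3) r(3)] conv[OF s(4) r(4)]])
    have "(s1 + k * (r1 - s1)) * a1 + (s2 + k * (r2 - s2)) * a2 + (s3 + k * (r3 - s3)) * a3
        + (s4 + k * (r4 - s4)) * a4
      = (1 - k) * (s1 * a1 + s2 * a2 + s3 * a3 + s4 * a4) + k * (r1 * a1 + r2 * a2 + r3 * a3 + r4 * a4)"
      by (simp add: algebra_simps)
    then show "(s1 + k * (r1 - s1)) * a1 + (s2 + k * (r2 - s2)) * a2 + (s3 + k * (r3 - s3)) * a3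
        + (s4 + k * (r4 - s4)) * a4 = 3"
      unfolding sa ra by simp
    have "(s1 + k * (r1 - s1)) * b1 + (s2 + k * (r2 - s2)) * b2 + (s3 + k * (r3 - s3)) * b3
        + (s4 + k * (r4 - s4)) * b4
      = (1 - k) * (s1 * b1 + s2 * b2 + s3 * b3 + s4 * b4) + k * (r1 * b1 + r2 * b2 + r3 * b3 + r4 * b4)"
      by (simp add: algebra_simps)
    then show "(s1 + k * (r1 - s1)) * b1 + (s2 + k * (r2 - s2)) * b2 + (s3 + k * (r3 - s3)) * b3
        + (s4 + k * (r4 - s4)) * b4 = v"
      unfolding sb rb k(3)[symmetric] by (simp add: algebra_simps)
  qed
qed

text \<open>An interval of values without multiples of 6 fits into one open gap between consecutive
  ones. The pattern lemmas exhibit values that cannot share a gap; the second conclusion keeps their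
  reasoning in the integers.\<close>

lemma slice_gap:
  fixes v\<^sub>0 :: real
  assumes "\<nexists>k::int. slice a b (6 * real_of_int k)" "slice a b v\<^sub>0"
  obtains k :: int
  where "\<And>v :: real. slice a b v \<Longrightarrow> 6 * real_of_int k < v \<and> v < 6 * real_of_int k + 6"
    and "\<And>v :: int. slice a b (of_int v) \<Longrightarrow> 6 * k < v \<and> v < 6 * k + 6"
proof -
  define k where "k = \<lfloor>v\<^sub>0 / 6\<rfloor>"
  have k: "6 * real_of_int k \<le> v\<^sub>0" "v\<^sub>0 < 6 * real_of_int k + 6"
    unfolding k_def by linarith+
  have gap: "6 * real_of_int k < v \<and> v < 6 * real_of_int k + 6" if v: "slice a b v" for v :: real
  proof (rule ccontr)
    assume "\<not> (6 * real_of_int k < v \<and> v < 6 * real_of_int k + 6)"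
    then consider "v \<le> 6 * real_of_int k" | "6 * real_of_int (k + 1) \<le> v"
      by fastforce
    then show False
    proof cases
      case 1
      then show False
        using slice_convex[OF v assms(2), of "6 * real_of_int k"] k assms(1) by blast
    next
      case 2
      then have "slice a b (6 * real_of_int (k + 1))"
        using slice_convex[OF assms(2) v, of "6 * real_of_int (k + 1)"] k by simp
      then show False using assms(1) by blast
    qed
  qed
  show ?thesis
  proof (rule that[OF gap])
    show "6 * k < v \<and> v < 6 * k + 6" if "slice a b (of_int v)" for v :: int
    proof -
      have "real_of_int (6 * k) < v" "v < real_of_int (6 * k + 6)"
        using gap[OF that] by auto
      then show ?thesis by (simp only: of_int_less_iff)
    qed
  qed
qed

lemma sgn_times_abs_int: "sgn b * b = \<bar>b\<bar>" "sgn (real_of_int b) * real_of_int b = of_int \<bar>b\<bar>" for b :: int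
  by (simp_all add: sgn_if)

text \<open>The only even integers strictly inside the gap are \<open>6 * k + 2\<close> and
  \<open>6 * k + 4\<close>, so \<open>m - r\<close> and \<open>m + r\<close> must be exactly these
  two.\<close>

lemma gap_centre:
  fixes m r k :: int
  assumes "even (m + r)" "1 \<le> r" "6 * k < m + r \<and> m + r < 6 * k + 6" "6 * k < m - r \<and> m - r < 6 * k + 6"
  shows "r = 1 \<and> m = 6 * k + 3"
  using assms by presburger

text \<open>Without parity the gap still holds only the five integers from \<open>6 * k + 1\<close>
  to \<open>6 * k + 5\<close>, so a spread \<open>2 * r\<close> of at least 4 fills it.\<close>

lemma gap_bound:
  fixes m r k :: int
  assumes "6 * k < m + r \<and> m + r < 6 * k + 6" "6 * k < m - r \<and> m - r < 6 * k + 6" "2 \<le> r"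
  shows "r = 2 \<and> m = 6 * k + 3"
  using assms by linarith

lemma gap_even:
  fixes v k :: int
  assumes "even v" "6 * k < v \<and> v < 6 * k + 6"
  shows "v = 6 * k + 2 \<or> v = 6 * k + 4"
  using assms by presburger

section \<open>The nine patterns of absolute values with sum 3 or 5\<close>

lemma slice_3000:
  fixes b1 b2 b3 b4 :: int
  assumes "b2 \<noteq> 0" "b3 \<noteq> 0" "b4 \<noteq> 0"
  shows "\<exists>k::int. slice (3, 0, 0, 0) (b1, b2, b3, b4) (6 * real_of_int k)"
proof (rule ccontr)
  let ?P = "slice (3, 0, 0, 0) (b1, b2, b3, b4)"
  assume none: "\<nexists>k::int. ?P (6 * real_of_int k)"
  \<comment> \<open>Coordinates where the pattern is 0 are free. Giving them the signs of
    \<open>b\<close>, or the opposite signs, moves the value by the full radius up or down; the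
    other patterns use the same choice. Here the two extremes are at least 6 apart.\<close>
  have 1: "?P (of_int (b1 + (\<bar>b2\<bar> + \<bar>b3\<bar> + \<bar>b4\<bar>)))"
    by (rule sliceI[of 1 "sgn (real_of_int b2)" "sgn (real_of_int b3)" "sgn (real_of_int b4)"]) (auto simp: sgn_times_abs_int abs_sgn_eq)
  have 2: "?P (of_int (b1 - (\<bar>b2\<bar> + \<bar>b3\<bar> + \<bar>b4\<bar>)))"
    by (rule sliceI[of 1 "- sgn (real_of_int b2)" "- sgn (real_of_int b3)" "- sgn (real_of_int b4)"]) (auto simp: sgn_times_abs_int abs_sgn_eq)
  obtain k where k: "\<And>v. ?P (of_int v) \<Longrightarrow> 6 * k < v \<and> v < 6 * k + 6"
    using slice_gap[OF none 1] by metis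
  show False
    using k[OF 1] k[OF 2] assms by linarith
qed

text \<open>Parity makes both extremes even, so \<open>gap_centre\<close> would force the radius
  \<open>\<bar>b3\<bar> + \<bar>b4\<bar>\<close> to be 1, although it is at least 2.\<close>

lemma slice_2100:
  fixes b1 b2 b3 b4 :: int
  assumes "b3 \<noteq> 0" "b4 \<noteq> 0" "even (b1 + b2 + b3 + b4)"
  shows "\<exists>k::int. slice (2, 1, 0, 0) (b1, b2, b3, b4) (6 * real_of_int k)"
proof (rule ccontr)
  let ?P = "slice (2, 1, 0, 0) (b1, b2, b3, b4)"
  assume none: "\<nexists>k::int. ?P (6 * real_of_int k)"
  have 1: "?P (of_int (b1 + b2 + (\<bar>b3\<bar> + \<bar>b4\<bar>)))"
    by (rule sliceI[of 1 1 "sgn (real_of_int b3)" "sgn (real_of_int b4)"]) (auto simp: sgn_times_abs_int abs_sgn_eq)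
  have 2: "?P (of_int (b1 + b2 - (\<bar>b3\<bar> + \<bar>b4\<bar>)))"
    by (rule sliceI[of 1 1 "- sgn (real_of_int b3)" "- sgn (real_of_int b4)"]) (auto simp: sgn_times_abs_int abs_sgn_eq)
  obtain k where k: "\<And>v. ?P (of_int v) \<Longrightarrow> 6 * k < v \<and> v < 6 * k + 6"
    using slice_gap[OF none 1] by metis
  have "even (b1 + b2 + (\<bar>b3\<bar> + \<bar>b4\<bar>))" "1 \<le> \<bar>b3\<bar> + \<bar>b4\<bar>"
    using assms by auto
  from gap_centre[OF this k[OF 1] k[OF 2]] show False
    using assms(1,2) by linarith
qed

text \<open>The equation forces \<open>s1 = s2 = s3 = 1\<close>, so only \<open>s4\<close> varies.
  By \<open>gap_centre\<close> the resulting interval avoids the multiples of 6 only with radius 1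
  around some \<open>6 * k + 3\<close>, which is the excluded configuration.\<close>

lemma slice_1110:
  fixes b1 b2 b3 b4 :: int
  assumes "b4 \<noteq> 0" "even (b1 + b2 + b3 + b4)" "\<not> (\<bar>b4\<bar> = 1 \<and> 3 dvd b1 + b2 + b3)"
  shows "\<exists>k::int. slice (1, 1, 1, 0) (b1, b2, b3, b4) (6 * real_of_int k)"
proof (rule ccontr)
  let ?P = "slice (1, 1, 1, 0) (b1, b2, b3, b4)"
  assume none: "\<nexists>k::int. ?P (6 * real_of_int k)"
  have 1: "?P (of_int (b1 + b2 + b3 + \<bar>b4\<bar>))"
    by (rule sliceI[of 1 1 1 "sgn (real_of_int b4)"]) (auto simp: sgn_times_abs_int abs_sgn_eq)
  have 2: "?P (of_int (b1 + b2 + b3 - \<bar>b4\<bar>))"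
    by (rule sliceI[of 1 1 1 "- sgn (real_of_int b4)"]) (auto simp: sgn_times_abs_int abs_sgn_eq)
  obtain k where k: "\<And>v. ?P (of_int v) \<Longrightarrow> 6 * k < v \<and> v < 6 * k + 6"
    using slice_gap[OF none 1] by metis
  have "even (b1 + b2 + b3 + \<bar>b4\<bar>)" "1 \<le> \<bar>b4\<bar>"
    using assms by auto
  from gap_centre[OF this k[OF 1] k[OF 2]] have g: "\<bar>b4\<bar> = 1" "b1 + b2 + b3 = 6 * k + 3"
    by blast+
  have "3 dvd b1 + b2 + b3"
    unfolding g(2) by presburger
  then show False
    using assms(3) g(1) by blast
qed

lemma slice_5000:
  fixes b1 b2 b3 b4 :: int
  assumes "b2 \<noteq> 0" "b3 \<noteq> 0" "b4 \<noteq> 0"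
  shows "\<exists>k::int. slice (5, 0, 0, 0) (b1, b2, b3, b4) (6 * real_of_int k)"
proof (rule ccontr)
  let ?P = "slice (5, 0, 0, 0) (b1, b2, b3, b4)"
  assume none: "\<nexists>k::int. ?P (6 * real_of_int k)"
  \<comment> \<open>The value \<open>s1 = 3 / 5\<close> is forced, and the centre need not be an
    integer. Hence the real form of the gap is used: the spread is at least 6, the length of the
    open gap.\<close>
  have 1: "?P (3 / 5 * b1 + of_int (\<bar>b2\<bar> + \<bar>b3\<bar> + \<bar>b4\<bar>))"
    by (rule sliceI[of "3 / 5" "sgn (real_of_int b2)" "sgn (real_of_int b3)" "sgn (real_of_int b4)"]) (auto simp: sgn_times_abs_int abs_sgn_eq)
  have 2: "?P (3 / 5 * b1 - of_int (\<bar>b2\<bar> + \<bar>b3\<bar> + \<bar>b4\<bar>))"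
    by (rule sliceI[of "3 / 5" "- sgn (real_of_int b2)" "- sgn (real_of_int b3)" "- sgn (real_of_int b4)"])
      (auto simp: sgn_times_abs_int abs_sgn_eq)
  obtain k where k: "\<And>v. ?P v \<Longrightarrow> 6 * real_of_int k < v \<and> v < 6 * real_of_int k + 6"
    using slice_gap[OF none 1] by metis
  have "\<bar>b2\<bar> + \<bar>b3\<bar> + \<bar>b4\<bar> \<ge> 3" using assms by linarith
  then have "real_of_int (\<bar>b2\<bar> + \<bar>b3\<bar> + \<bar>b4\<bar>) \<ge> 3" by linarith
  then show False
    using k[OF 1] k[OF 2] by linarith
qed

text \<open>At the vertex \<open>s1 = 1\<close>, \<open>s2 = - 1\<close> the argument for the
  pattern \<open>(2, 1, 0, 0)\<close> applies again.\<close>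

lemma slice_4100:
  fixes b1 b2 b3 b4 :: int
  assumes "b3 \<noteq> 0" "b4 \<noteq> 0" "even (b1 + b2 + b3 + b4)"
  shows "\<exists>k::int. slice (4, 1, 0, 0) (b1, b2, b3, b4) (6 * real_of_int k)"
proof (rule ccontr)
  let ?P = "slice (4, 1, 0, 0) (b1, b2, b3, b4)"
  assume none: "\<nexists>k::int. ?P (6 * real_of_int k)"
  have 1: "?P (of_int (b1 - b2 + (\<bar>b3\<bar> + \<bar>b4\<bar>)))"
    by (rule sliceI[of 1 "-1" "sgn (real_of_int b3)" "sgn (real_of_int b4)"]) (auto simp: sgn_times_abs_int abs_sgn_eq)
  have 2: "?P (of_int (b1 - b2 - (\<bar>b3\<bar> + \<bar>b4\<bar>)))"
    by (rule sliceI[of 1 "-1" "- sgn (real_of_int b3)" "- sgn (real_of_int b4)"]) (auto simp: sgn_times_abs_int abs_sgn_eq)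
  obtain k where k: "\<And>v. ?P (of_int v) \<Longrightarrow> 6 * k < v \<and> v < 6 * k + 6"
    using slice_gap[OF none 1] by metis
  have "even (b1 - b2 + (\<bar>b3\<bar> + \<bar>b4\<bar>))" "1 \<le> \<bar>b3\<bar> + \<bar>b4\<bar>"
    using assms by auto
  from gap_centre[OF this k[OF 1] k[OF 2]] show False
    using assms(1,2) by linarith
qed

text \<open>The points \<open>(1, 0)\<close> and \<open>(1 / 3, 1)\<close> are the ends of the
  segment \<open>3 * s1 + 2 * s2 = 3\<close> in the square. The first has no parity information but
  forces radius 2 and \<open>b1 = 6 * k + 3\<close>. This makes \<open>b1 / 3\<close> an integer,
  and at the second end parity demands radius 1.\<close>

lemma slice_3200:
  fixes b1 b2 b3 b4 :: int
  assumes "b3 \<noteq> 0" "b4 \<noteq> 0" "even (b1 + b2 + b3 + b4)"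
  shows "\<exists>k::int. slice (3, 2, 0, 0) (b1, b2, b3, b4) (6 * real_of_int k)"
proof (rule ccontr)
  let ?P = "slice (3, 2, 0, 0) (b1, b2, b3, b4)"
  assume none: "\<nexists>k::int. ?P (6 * real_of_int k)"
  have 1: "?P (of_int (b1 + (\<bar>b3\<bar> + \<bar>b4\<bar>)))"
    by (rule sliceI[of 1 0 "sgn (real_of_int b3)" "sgn (real_of_int b4)"]) (auto simp: sgn_times_abs_int abs_sgn_eq)
  have 2: "?P (of_int (b1 - (\<bar>b3\<bar> + \<bar>b4\<bar>)))"
    by (rule sliceI[of 1 0 "- sgn (real_of_int b3)" "- sgn (real_of_int b4)"]) (auto simp: sgn_times_abs_int abs_sgn_eq)
  have 3: "?P (1 / 3 * b1 + of_int (b2 + (\<bar>b3\<bar> + \<bar>b4\<bar>)))"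
    by (rule sliceI[of "1 / 3" 1 "sgn (real_of_int b3)" "sgn (real_of_int b4)"]) (auto simp: sgn_times_abs_int abs_sgn_eq)
  have 4: "?P (1 / 3 * b1 + of_int (b2 - (\<bar>b3\<bar> + \<bar>b4\<bar>)))"
    by (rule sliceI[of "1 / 3" 1 "- sgn (real_of_int b3)" "- sgn (real_of_int b4)"]) (auto simp: sgn_times_abs_int abs_sgn_eq)
  obtain k where k: "\<And>v. ?P (of_int v) \<Longrightarrow> 6 * k < v \<and> v < 6 * k + 6"
    and kr: "\<And>v. ?P v \<Longrightarrow> 6 * real_of_int k < v \<and> v < 6 * real_of_int k + 6"
    using slice_gap[OF none 1] by metis
  have r: "2 \<le> \<bar>b3\<bar> + \<bar>b4\<bar>"
    using assms by linarith
  have b34: "\<bar>b3\<bar> + \<bar>b4\<bar> = 2" and b1: "b1 = 6 * k + 3"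
    using gap_bound[OF k[OF 1] k[OF 2] r] by auto
  have "1 / 3 * real_of_int b1 = of_int (2 * k + 1)"
    using b1 by simp
  then have "?P (of_int (2 * k + 1 + b2 + 2))" "?P (of_int (2 * k + 1 + b2 - 2))"
    using 3 4 b34 by (simp_all add: algebra_simps)
  moreover have "even (b1 + b2 + (\<bar>b3\<bar> + \<bar>b4\<bar>))"
    using assms(3) by auto
  then have "even (2 * k + 1 + b2 + 2)"
    unfolding b1 b34 by presburger
  ultimately show False
    using gap_centre[of "2 * k + 1 + b2" 2 k] k by auto
qed

text \<open>The vertices \<open>(1, 1, - 1)\<close> and \<open>(1, - 1, 1)\<close> force
  \<open>\<bar>b4\<bar> = 1\<close>, \<open>b2 = b3\<close> and \<open>b1 = 6 * k + 3\<close>; then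
  \<open>(1 / 3, 1, 1)\<close> forces \<open>b2 = 2 * k + 1\<close>. So \<open>b\<close> minus
  \<open>b2\<close> times the pattern is a signed unit vector, which \<open>loopfree\<close>
  forbids.\<close>

lemma slice_3110:
  fixes b1 b2 b3 b4 :: int
  assumes "b4 \<noteq> 0" "even (b1 + b2 + b3 + b4)"
    and loopfree: "\<And>c. (b1 - c * 3, b2 - c, b3 - c) = (0, 0, 0) \<Longrightarrow> \<bar>b4\<bar> \<noteq> 1"
  shows "\<exists>k::int. slice (3, 1, 1, 0) (b1, b2, b3, b4) (6 * real_of_int k)"
proof (rule ccontr)
  let ?P = "slice (3, 1, 1, 0) (b1, b2, b3, b4)"
  assume none: "\<nexists>k::int. ?P (6 * real_of_int k)"
  have 1: "?P (of_int (b1 + b2 - b3 + \<bar>b4\<bar>))"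
    by (rule sliceI[of 1 1 "-1" "sgn (real_of_int b4)"]) (auto simp: sgn_times_abs_int abs_sgn_eq)
  have 2: "?P (of_int (b1 + b2 - b3 - \<bar>b4\<bar>))"
    by (rule sliceI[of 1 1 "-1" "- sgn (real_of_int b4)"]) (auto simp: sgn_times_abs_int abs_sgn_eq)
  have 3: "?P (of_int (b1 - b2 + b3 + \<bar>b4\<bar>))"
    by (rule sliceI[of 1 "-1" 1 "sgn (real_of_int b4)"]) (auto simp: sgn_times_abs_int abs_sgn_eq)
  have 4: "?P (of_int (b1 - b2 + b3 - \<bar>b4\<bar>))"
    by (rule sliceI[of 1 "-1" 1 "- sgn (real_of_int b4)"]) (auto simp: sgn_times_abs_int abs_sgn_eq)
  have 5: "?P (1 / 3 * b1 + of_int (b2 + b3 + \<bar>b4\<bar>))"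
    by (rule sliceI[of "1 / 3" 1 1 "sgn (real_of_int b4)"]) (auto simp: sgn_times_abs_int abs_sgn_eq)
  have 6: "?P (1 / 3 * b1 + of_int (b2 + b3 - \<bar>b4\<bar>))"
    by (rule sliceI[of "1 / 3" 1 1 "- sgn (real_of_int b4)"]) (auto simp: sgn_times_abs_int abs_sgn_eq)
  obtain k where k: "\<And>v. ?P (of_int v) \<Longrightarrow> 6 * k < v \<and> v < 6 * k + 6"
    using slice_gap[OF none 1] by metis
  have par: "even (b1 + b2 - b3 + \<bar>b4\<bar>)" "even (b1 - b2 + b3 + \<bar>b4\<bar>)" "1 \<le> \<bar>b4\<bar>"
    using assms(1,2) by auto
  have b4: "\<bar>b4\<bar> = 1"
    using gap_centre[OF par(1,3) k[OF 1] k[OF 2]] by blast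
  have b: "b3 = b2" "b1 = 6 * k + 3"
    using gap_centre[OF par(1,3) k[OF 1] k[OF 2]] gap_centre[OF par(2,3) k[OF 3] k[OF 4]] by linarith+
  have "1 / 3 * real_of_int b1 = of_int (2 * k + 1)"
    using b by simp
  then have "?P (of_int (2 * k + 1 + 2 * b2 + 1))" "?P (of_int (2 * k + 1 + 2 * b2 - 1))"
    using 5 6 b4 b by (simp_all add: algebra_simps)
  from k[OF this(1)] k[OF this(2)] have "b2 = 2 * k + 1" by presburger
  then show False
    using loopfree[of b2] b b4 by simp
qed

text \<open>The vertex \<open>(1, 1, - 1)\<close> fixes \<open>\<bar>b4\<bar> = 1\<close> and
  \<open>b1 + b2 - b3\<close>. The vertices \<open>(1, 0, 1)\<close> and \<open>(0, 1, 1)\<close>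
  then bring \<open>b1\<close> and \<open>b2\<close> within 1 of \<open>2 * b3\<close>, so
  \<open>b\<close> minus \<open>b3\<close> times the pattern has 1-norm at most 3, against
  \<open>far\<close>.\<close>

lemma slice_2210:
  fixes b1 b2 b3 b4 :: int
  assumes "b4 \<noteq> 0" "even (b1 + b2 + b3 + b4)"
    and far: "\<And>c. 5 \<le> \<bar>b1 - c * 2\<bar> + \<bar>b2 - c * 2\<bar> + \<bar>b3 - c\<bar> + \<bar>b4\<bar>"
  shows "\<exists>k::int. slice (2, 2, 1, 0) (b1, b2, b3, b4) (6 * real_of_int k)"
proof (rule ccontr)
  let ?P = "slice (2, 2, 1, 0) (b1, b2, b3, b4)"
  assume none: "\<nexists>k::int. ?P (6 * real_of_int k)"
  have 1: "?P (of_int (b1 + b2 - b3 + \<bar>b4\<bar>))"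
    by (rule sliceI[of 1 1 "-1" "sgn (real_of_int b4)"]) (auto simp: sgn_times_abs_int abs_sgn_eq)
  have 2: "?P (of_int (b1 + b2 - b3 - \<bar>b4\<bar>))"
    by (rule sliceI[of 1 1 "-1" "- sgn (real_of_int b4)"]) (auto simp: sgn_times_abs_int abs_sgn_eq)
  have 3: "?P (of_int (b1 + b3 + \<bar>b4\<bar>))"
    by (rule sliceI[of 1 0 1 "sgn (real_of_int b4)"]) (auto simp: sgn_times_abs_int abs_sgn_eq)
  have 4: "?P (of_int (b1 + b3 - \<bar>b4\<bar>))"
    by (rule sliceI[of 1 0 1 "- sgn (real_of_int b4)"]) (auto simp: sgn_times_abs_int abs_sgn_eq)
  have 5: "?P (of_int (b2 + b3 + \<bar>b4\<bar>))"
    by (rule sliceI[of 0 1 1 "sgn (real_of_int b4)"]) (auto simp: sgn_times_abs_int abs_sgn_eq)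
  have 6: "?P (of_int (b2 + b3 - \<bar>b4\<bar>))"
    by (rule sliceI[of 0 1 1 "- sgn (real_of_int b4)"]) (auto simp: sgn_times_abs_int abs_sgn_eq)
  obtain k where k: "\<And>v. ?P (of_int v) \<Longrightarrow> 6 * k < v \<and> v < 6 * k + 6"
    using slice_gap[OF none 1] by metis
  have "even (b1 + b2 - b3 + \<bar>b4\<bar>)" "1 \<le> \<bar>b4\<bar>"
    using assms(1,2) by auto
  from gap_centre[OF this k[OF 1] k[OF 2]] have "\<bar>b4\<bar> = 1" "b1 + b2 - b3 = 6 * k + 3"
    by blast+
  then have "\<bar>b1 - b3 * 2\<bar> \<le> 1" "\<bar>b2 - b3 * 2\<bar> \<le> 1"
    using k[OF 3] k[OF 4] k[OF 5] k[OF 6] unfolding \<open>\<bar>b4\<bar> = 1\<close> by linarith+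
  then show False
    using far[of b3] \<open>\<bar>b4\<bar> = 1\<close> by linarith
qed

text \<open>The three vertices with one coordinate \<open>- 1\<close> give even values in one gap,
  hence only two possible values. Two of them agree, so two of \<open>b2\<close>, \<open>b3\<close>,
  \<open>b4\<close> are equal, and the third differs by at most 1. Subtracting that common entry
  times the pattern leaves 1-norm at most 4, against \<open>far\<close>.\<close>

lemma slice_2111:
  fixes b1 b2 b3 b4 :: int
  assumes "even (b1 + b2 + b3 + b4)"
    and far: "\<And>c. 5 \<le> \<bar>b1 - c * 2\<bar> + \<bar>b2 - c\<bar> + \<bar>b3 - c\<bar> + \<bar>b4 - c\<bar>"
  shows "\<exists>k::int. slice (2, 1, 1, 1) (b1, b2, b3, b4) (6 * real_of_int k)"
proof (rule ccontr)
  let ?P = "slice (2, 1, 1, 1) (b1, b2, b3, b4)"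
  assume none: "\<nexists>k::int. ?P (6 * real_of_int k)"
  have 1: "?P (of_int (b2 + b3 + b4))"
    by (rule sliceI[of 0 1 1 1]) auto
  have 2: "?P (of_int (b1 - b2 + b3 + b4))"
    by (rule sliceI[of 1 "-1" 1 1]) auto
  have 3: "?P (of_int (b1 + b2 - b3 + b4))"
    by (rule sliceI[of 1 1 "-1" 1]) auto
  have 4: "?P (of_int (b1 + b2 + b3 - b4))"
    by (rule sliceI[of 1 1 1 "-1"]) auto
  obtain k where k: "\<And>v. ?P (of_int v) \<Longrightarrow> 6 * k < v \<and> v < 6 * k + 6"
    using slice_gap[OF none 1] by metis
  note low = k[OF 1]
  have ev: "b1 - b2 + b3 + b4 = 6 * k + 2 \<or> b1 - b2 + b3 + b4 = 6 * k + 4"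
    "b1 + b2 - b3 + b4 = 6 * k + 2 \<or> b1 + b2 - b3 + b4 = 6 * k + 4"
    "b1 + b2 + b3 - b4 = 6 * k + 2 \<or> b1 + b2 + b3 - b4 = 6 * k + 4"
    by (rule gap_even[OF _ k[OF 2]] gap_even[OF _ k[OF 3]] gap_even[OF _ k[OF 4]]; use assms(1) in simp)+
  consider "b2 = b3" | "b2 = b4" | "b3 = b4"
    using ev by linarith
  then show False
  proof cases
    case 1
    then have "\<bar>b3 - b2\<bar> = 0" "\<bar>b4 - b2\<bar> \<le> 1" "\<bar>b1 - b2 * 2\<bar> \<le> 3"
      using low ev by linarith+
    then show ?thesis using far[of b2] by simp
  next
    case 2
    then have "\<bar>b4 - b2\<bar> = 0" "\<bar>b3 - b2\<bar> \<le> 1" "\<bar>b1 - b2 * 2\<bar> \<le> 3"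
      using low ev by linarith+
    then show ?thesis using far[of b2] by simp
  next
    case 3
    then have "\<bar>b4 - b3\<bar> = 0" "\<bar>b2 - b3\<bar> \<le> 1" "\<bar>b1 - b3 * 2\<bar> \<le> 3"
      using low ev by linarith+
    then show ?thesis using far[of b3] by simp
  qed
qed

section \<open>Reduced pairs and zonotopes\<close>

definition l1_norm :: "int ^ 'm::finite \<Rightarrow> int" where
  "l1_norm x = (\<Sum>i\<in>UNIV. \<bar>x $ i\<bar>)"

lemma l1_norm_nonneg: "0 \<le> l1_norm x"
  by (simp add: l1_norm_def sum_nonneg)

lemma l1_norm_minus [simp]: "l1_norm (- x) = l1_norm x"
  by (simp add: l1_norm_def)

lemma even_l1_norm: "even (l1_norm x) \<longleftrightarrow> even (\<Sum>i\<in>UNIV. x $ i)"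
proof -
  have "even (\<Sum>i\<in>A. \<bar>x $ i\<bar>) \<longleftrightarrow> even (\<Sum>i\<in>A. x $ i)" if "finite A" for A
    using that by (induction A rule: finite_induct) auto
  then show ?thesis by (simp add: l1_norm_def)
qed

text \<open>Triangle inequalities compare \<open>x + u * y\<close> with the lattice points
  \<open>x\<close>, \<open>x + y\<close> and \<open>2 *s x + y\<close>, whose norms are bounded
  below by hypothesis. The second bound uses whichever of 0 and 1 is nearer to
  \<open>u\<close>.\<close>

lemma reduced_pair_bound_nonneg:
  fixes x y :: "int ^ 'm::finite" and u :: real
  assumes "0 \<le> u" "l1_norm x \<le> l1_norm (x + y)" "l1_norm y \<le> l1_norm (y + 2 *s x)"
  shows "l1_norm x \<le> 2 * (\<Sum>i\<in>UNIV. \<bar>x $ i + u * y $ i\<bar>)"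
    and "l1_norm x - l1_norm y / 2 \<le> (\<Sum>i\<in>UNIV. \<bar>x $ i + u * y $ i\<bar>)"
proof -
  define N where "N v w = (\<Sum>i\<in>UNIV. \<bar>v * x $ i + w * y $ i\<bar>)" for v w :: real
  have tri: "N (v + v') (w + w') \<le> N v w + N v' w'" for v w v' w'
    unfolding N_def sum.distrib[symmetric]
  proof (rule sum_mono)
    fix i
    have "(v + v') * x $ i + (w + w') * y $ i = (v * x $ i + w * y $ i) + (v' * x $ i + w' * y $ i)"
      by (simp add: algebra_simps)
    then show "\<bar>(v + v') * x $ i + (w + w') * y $ i\<bar>
        \<le> \<bar>v * x $ i + w * y $ i\<bar> + \<bar>v' * x $ i + w' * y $ i\<bar>"
      by linarith
  qed
  have scale: "N (c * v) (c * w) = \<bar>c\<bar> * N v w" for c v w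
    unfolding N_def sum_distrib_left abs_mult[symmetric] by (simp add: algebra_simps)
  have N_int: "N (of_int k) (of_int l) = l1_norm (k *s x + l *s y)" for k l
    by (simp add: N_def l1_norm_def)
  define n W L where "n = N 1 u" and "W = real_of_int (l1_norm x)" and "L = real_of_int (l1_norm y)"
  have n: "(\<Sum>i\<in>UNIV. \<bar>x $ i + u * y $ i\<bar>) = n"
    by (simp add: n_def N_def)
  have n0: "0 \<le> n" "0 \<le> L"
    by (simp_all add: n_def N_def sum_nonneg L_def l1_norm_nonneg)
  have N10: "N 1 0 = W" and N01: "N 0 1 = L"
    using N_int[of 1 0] N_int[of 0 1] by (simp_all add: W_def L_def)
  have W: "W \<le> N 1 1" and L: "L \<le> N 2 1"
    using N_int[of 1 1] N_int[of 2 1] assms by (simp_all add: W_def L_def add.commute)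
  have "W \<le> n + u * L"
    using tri[of 1 0 u "- u"] scale[of "- u" 0 1] assms(1) by (simp add: n_def N10 N01)
  moreover have "W \<le> n + \<bar>1 - u\<bar> * L"
    using W tri[of 1 0 u "1 - u"] scale[of "1 - u" 0 1] by (simp add: n_def N01)
  \<comment> \<open>Since \<open>2 x + y\<close> equals \<open>2 (x + u y) + (1 - 2 u) y\<close>,
    this gives \<open>u * L \<le> n\<close> for \<open>u \<le> 1 / 2\<close> and
    \<open>(1 - u) * L \<le> n\<close> for \<open>u\<close> between \<open>1 / 2\<close> and 1.
    Combined with one of the two estimates above it yields \<open>W \<le> 2 * n\<close>.\<close>
  moreover have "L \<le> 2 * n + \<bar>1 - 2 * u\<bar> * L"
    using L tri[of 2 0 "2 * u" "1 - 2 * u"] scale[of "1 - 2 * u" 0 1] scale[of 2 1 u]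
    by (simp add: n_def N01)
  \<comment> \<open>Beyond \<open>u = 1\<close> the comparison vector is \<open>u (x + y)\<close>,
    which equals \<open>(x + u y) + (u - 1) x\<close>.\<close>
  moreover have "W \<le> n" if "u > 1"
  proof -
    have "u * W \<le> N u u"
      using scale[of u 1 1] W that by (simp add: mult_left_mono)
    also have "\<dots> \<le> n + (u - 1) * W"
      using tri[of 1 "u - 1" u 0] scale[of "u - 1" 1 0] that by (simp add: n_def N10)
    finally show ?thesis by (simp add: algebra_simps)
  qed
  moreover have "u * L \<le> L / 2" if "u \<le> 1 / 2"
    using mult_right_mono[OF that n0(2)] by simp
  moreover have "(1 - u) * L \<le> L / 2" if "1 / 2 \<le> u"
    using mult_right_mono[of "1 - u" "1 / 2" L] that n0(2) by simp
  ultimately have "W \<le> 2 * n \<and> W - L / 2 \<le> n"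
    using n0 by (cases "u \<le> 1 / 2"; cases "u \<le> 1") (auto simp: algebra_simps)
  then show "l1_norm x \<le> 2 * (\<Sum>i\<in>UNIV. \<bar>x $ i + u * y $ i\<bar>)"
    and "l1_norm x - l1_norm y / 2 \<le> (\<Sum>i\<in>UNIV. \<bar>x $ i + u * y $ i\<bar>)"
    unfolding n W_def L_def by simp_all
qed

text \<open>A negative \<open>u\<close> is the nonnegative case for \<open>- y\<close>, whose
  hypotheses are the ones with minus signs.\<close>

lemma reduced_pair_bound:
  fixes x y :: "int ^ 'm::finite" and u :: real
  assumes "l1_norm x \<le> l1_norm (x + y)" "l1_norm x \<le> l1_norm (x - y)"
    and "l1_norm y \<le> l1_norm (y + 2 *s x)" "l1_norm y \<le> l1_norm (y - 2 *s x)"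
  shows "l1_norm x \<le> 2 * (\<Sum>i\<in>UNIV. \<bar>x $ i + u * y $ i\<bar>)"
    and "l1_norm x - l1_norm y / 2 \<le> (\<Sum>i\<in>UNIV. \<bar>x $ i + u * y $ i\<bar>)"
proof -
  have "l1_norm (2 *s x - y) = l1_norm (y - 2 *s x)"
    using l1_norm_minus[of "y - 2 *s x"] by simp
  then have "l1_norm (- y) \<le> l1_norm (- y + 2 *s x)"
    using assms(4) by simp
  then show "l1_norm x \<le> 2 * (\<Sum>i\<in>UNIV. \<bar>x $ i + u * y $ i\<bar>)"
    and "l1_norm x - l1_norm y / 2 \<le> (\<Sum>i\<in>UNIV. \<bar>x $ i + u * y $ i\<bar>)"
    using reduced_pair_bound_nonneg[of u x y] reduced_pair_bound_nonneg[of "- u" x "- y"] assms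
    by (cases "0 \<le> u"; simp)+
qed

text \<open>The zonotope \<open>K\<close> is compact and convex, and in direction
  \<open>(v, w)\<close> its support function is the sum of all
  \<open>\<bar>v * x $ i + w * y $ i\<bar>\<close>. By homogeneity \<open>bound\<close> makes this
  at least \<open>\<bar>v\<bar> * c\<close>, so no line separates \<open>(c, 0)\<close> from
  \<open>K\<close>.\<close>

lemma zonotope_contains_on_axis:
  fixes x y :: "int ^ 'm::finite" and c :: real
  assumes c: "0 \<le> c" and bound: "\<And>u :: real. c \<le> (\<Sum>i\<in>UNIV. \<bar>x $ i + u * y $ i\<bar>)"
  shows "\<exists>s :: 'm \<Rightarrow> real. (\<forall>i. \<bar>s i\<bar> \<le> 1) \<and> (\<Sum>i\<in>UNIV. s i * x $ i) = c \<and> (\<Sum>i\<in>UNIV. s i * y $ i) = 0"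
proof -
  define h :: "real ^ 'm \<Rightarrow> real \<times> real"
    where "h s = (\<Sum>i\<in>UNIV. s $ i * x $ i, \<Sum>i\<in>UNIV. s $ i * y $ i)" for s
  define K where "K = h ` cbox (\<chi> i. - 1) (\<chi> i. 1)"
  have lin: "linear h"
    by (rule linearI) (auto simp: h_def algebra_simps sum.distrib sum_distrib_left)
  have "convex K" unfolding K_def
    using lin by (intro convex_linear_image convex_box)
  moreover have "compact K" unfolding K_def
    using lin by (intro compact_continuous_image linear_continuous_on) (auto simp: linear_conv_bounded_linear)
  ultimately have K: "convex K" "closed K"
    by (auto intro: compact_imp_closed)
  have "(c, 0) \<in> K"
  proof (rule ccontr)
    assume "(c, 0) \<notin> K"
    then obtain n b where n: "inner n (c, 0) < b" "\<And>p. p \<in> K \<Longrightarrow> b < inner n p"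
      using separating_hyperplane_closed_point[OF K] by metis
    obtain v w where vw: "n = (v, w)" by fastforce
    \<comment> \<open>This point of the cube minimizes the separating functional.\<close>
    define s :: "real ^ 'm" where "s = (\<chi> i. - sgn (v * x $ i + w * y $ i))"
    have "s \<in> cbox (\<chi> i. - 1) (\<chi> i. 1)"
      by (auto simp: s_def mem_box_cart sgn_if)
    then have "h s \<in> K" by (simp add: K_def)
    from n(2)[OF this] have "v * c < inner n (h s)"
      using n(1) by (simp add: vw)
    also have "inner n (h s) = (\<Sum>i\<in>UNIV. s $ i * (v * x $ i + w * y $ i))"
      by (simp add: vw h_def sum_distrib_left sum.distrib[symmetric] algebra_simps)
    also have "\<dots> = - (\<Sum>i\<in>UNIV. \<bar>v * x $ i + w * y $ i\<bar>)"
      by (simp add: s_def sum_negf[symmetric] abs_sgn mult.commute)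
    finally have lt: "v * c < - (\<Sum>i\<in>UNIV. \<bar>v * x $ i + w * y $ i\<bar>)" .
    have pos: "0 \<le> (\<Sum>i\<in>UNIV. \<bar>v * x $ i + w * y $ i\<bar>)"
      by (simp add: sum_nonneg)
    show False
    proof (cases "v = 0")
      case True
      then have "v * c = 0" by simp
      then show False using lt pos by linarith
    next
      case False
      \<comment> \<open>The bound is used at \<open>u = w / v\<close>.\<close>
      have "\<bar>v\<bar> * c \<le> \<bar>v\<bar> * (\<Sum>i\<in>UNIV. \<bar>x $ i + w / v * y $ i\<bar>)"
        by (rule mult_left_mono[OF bound]) simp
      also have "\<dots> = (\<Sum>i\<in>UNIV. \<bar>v * x $ i + w * y $ i\<bar>)"
        unfolding sum_distrib_left abs_mult[symmetric] using False by (simp add: algebra_simps)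
      finally have "\<bar>v\<bar> * c \<le> (\<Sum>i\<in>UNIV. \<bar>v * x $ i + w * y $ i\<bar>)" .
      moreover have "- (\<bar>v\<bar> * c) \<le> v * c"
        using mult_right_mono[OF abs_ge_minus_self[of v] c] by simp
      ultimately show False
        using lt by linarith
    qed
  qed
  then obtain s where s: "s \<in> cbox (\<chi> i. - 1) (\<chi> i. 1)" and hs: "(c, 0) = h s"
    unfolding K_def by blast
  show ?thesis
  proof (intro exI[of _ "\<lambda>i. s $ i"] conjI allI)
    show "\<bar>s $ i\<bar> \<le> 1" for i
      using s unfolding mem_box_cart by (metis abs_le_iff minus_le_iff vec_lambda_beta)
  qed (use hs in \<open>auto simp: h_def\<close>)
qed

section \<open>Sorting the coordinates and listing the patterns of norms 3 and 5\<close>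

lemma obtain_sorted_4:
  fixes f :: "4 \<Rightarrow> int"
  obtains i1 i2 i3 i4 where "distinct [i1, i2, i3, i4]" "UNIV = {i1, i2, i3, i4}"
    and "f i2 \<le> f i1" "f i3 \<le> f i2" "f i4 \<le> f i3"
proof -
  define xs where "xs = sort_key (\<lambda>i. - f i) [1, 2, 3, 4 :: 4]"
  have "length xs = 4" by (simp add: xs_def)
  then obtain i1 i2 i3 i4 where xs: "xs = [i1, i2, i3, i4]"
    by (auto simp: numeral_eq_Suc length_Suc_conv)
  have 2: "set xs = UNIV"
    unfolding xs_def using exhaust_4 by auto
  have 1: "distinct xs"
    by (rule card_distinct) (simp add: 2 \<open>length xs = 4\<close>)
  have "sorted (map (\<lambda>i. - f i) xs)"
    by (simp add: xs_def)
  then show ?thesis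
    using that[of i1 i2 i3 i4] 1 2 by (auto simp: xs)
qed

lemma sum_UNIV_4:
  assumes "distinct [i1, i2, i3, i4 :: 4]" "UNIV = {i1, i2, i3, i4}"
  shows "(\<Sum>i\<in>UNIV. f i) = f i1 + f i2 + f i3 + (f i4 :: 'a::comm_monoid_add)"
  unfolding assms(2) using assms(1) by (simp add: add.assoc)

lemma sorted_sum_3:
  fixes a1 a2 a3 a4 :: int
  assumes "a2 \<le> a1" "a3 \<le> a2" "a4 \<le> a3" "0 \<le> a4" "a1 + a2 + a3 + a4 = 3"
  shows "(a1, a2, a3, a4) \<in> {(3, 0, 0, 0), (2, 1, 0, 0), (1, 1, 1, 0)}"
proof -
  have "a4 = 0" "a3 = 0 \<or> a3 = 1" "a2 = 0 \<or> a2 = 1" "a1 = 3 - a2 - a3 - a4"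
    using assms by linarith+
  then show ?thesis using assms(1-3) by (elim disjE; simp)
qed

lemma sorted_sum_5:
  fixes a1 a2 a3 a4 :: int
  assumes "a2 \<le> a1" "a3 \<le> a2" "a4 \<le> a3" "0 \<le> a4" "a1 + a2 + a3 + a4 = 5"
  shows "(a1, a2, a3, a4) \<in>
    {(5, 0, 0, 0), (4, 1, 0, 0), (3, 2, 0, 0), (3, 1, 1, 0), (2, 2, 1, 0), (2, 1, 1, 1)}"
proof -
  have "a4 = 0 \<or> a4 = 1" "a3 = 0 \<or> a3 = 1" "a2 = 0 \<or> a2 = 1 \<or> a2 = 2" "a1 = 5 - a2 - a3 - a4"
    using assms by linarith+
  then show ?thesis using assms(1-3) by (elim disjE; simp)
qed

text \<open>Sorting and sign changes bring \<open>x\<close> to one of the nine patterns, whose slice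
  lemmas supply \<open>s\<close>; the second alternative is the exceptional matrix up to signs and
  order of rows. The bound on \<open>y - c *s x\<close> serves the patterns of norm 5.\<close>

lemma slice_or_tomato_cage:
  fixes x y :: "int ^ 4"
  assumes nz: "\<And>i. x $ i \<noteq> 0 \<or> y $ i \<noteq> 0"
    and parity: "even (\<Sum>i\<in>UNIV. y $ i)"
    and norm: "l1_norm x = 3 \<or> l1_norm x = 5 \<and> (\<forall>c. 5 \<le> l1_norm (y - c *s x))"
  shows "(\<exists>(s :: 4 \<Rightarrow> real) (k :: int). (\<forall>i. \<bar>s i\<bar> \<le> 1) \<and> (\<Sum>i\<in>UNIV. s i * x $ i) = 3 \<and>
            (\<Sum>i\<in>UNIV. s i * y $ i) = 6 * real_of_int k) \<or>
         (\<exists>i1 i2 i3 i4. distinct [i1, i2, i3, i4] \<and> UNIV = {i1, i2, i3, i4} \<and>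
            \<bar>x $ i1\<bar> = 1 \<and> \<bar>x $ i2\<bar> = 1 \<and> \<bar>x $ i3\<bar> = 1 \<and> x $ i4 = 0 \<and> \<bar>y $ i4\<bar> = 1 \<and>
            3 dvd x $ i1 * y $ i1 + x $ i2 * y $ i2 + x $ i3 * y $ i3)"
proof -
  obtain i1 i2 i3 i4 where i: "distinct [i1, i2, i3, i4]" "UNIV = {i1, i2, i3, i4}"
    and sorted: "\<bar>x $ i2\<bar> \<le> \<bar>x $ i1\<bar>" "\<bar>x $ i3\<bar> \<le> \<bar>x $ i2\<bar>" "\<bar>x $ i4\<bar> \<le> \<bar>x $ i3\<bar>"
    by (rule obtain_sorted_4[of "\<lambda>i. \<bar>x $ i\<bar>"])
  \<comment> \<open>Unlike \<open>sgn\<close>, this sign is 1 where \<open>x\<close> vanishes, so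
    \<open>b\<close> keeps the entries of \<open>y\<close> there.\<close>
  define \<epsilon> :: "4 \<Rightarrow> int" where "\<epsilon> j = (if x $ j < 0 then - 1 else 1)" for j
  define b where "b j = \<epsilon> j * y $ j" for j
  have \<epsilon>: "x $ j = \<epsilon> j * \<bar>x $ j\<bar>" "\<epsilon> j * \<epsilon> j = 1" "\<bar>\<epsilon> j\<bar> = 1" "odd (\<epsilon> j)" for j
    by (auto simp: \<epsilon>_def)
  define T where "T = (\<bar>x $ i1\<bar>, \<bar>x $ i2\<bar>, \<bar>x $ i3\<bar>, \<bar>x $ i4\<bar>)"
  have from_slice: ?thesis if "\<exists>k::int. slice T (b i1, b i2, b i3, b i4) (6 * real_of_int k)"
  proof -
    from that obtain k where slice: "slice T (b i1, b i2, b i3, b i4) (6 * real_of_int k)"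
      by blast
    obtain s1 s2 s3 s4 :: real where
      s: "\<bar>s1\<bar> \<le> 1" "\<bar>s2\<bar> \<le> 1" "\<bar>s3\<bar> \<le> 1" "\<bar>s4\<bar> \<le> 1"
      and sx: "s1 * \<bar>x $ i1\<bar> + s2 * \<bar>x $ i2\<bar> + s3 * \<bar>x $ i3\<bar> + s4 * \<bar>x $ i4\<bar> = 3"
      and sy: "s1 * b i1 + s2 * b i2 + s3 * b i3 + s4 * b i4 = 6 * real_of_int k"
      using slice unfolding T_def by (rule sliceE)
    define s where "s j = \<epsilon> j * (if j = i1 then s1 else if j = i2 then s2 else if j = i3 then s3 else s4)" for j
    have s_eq: "s i1 = \<epsilon> i1 * s1" "s i2 = \<epsilon> i2 * s2" "s i3 = \<epsilon> i3 * s3" "s i4 = \<epsilon> i4 * s4"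
      using i(1) by (auto simp: s_def)
    have \<epsilon>x: "of_int (\<epsilon> j) * r * of_int (x $ j) = r * of_int \<bar>x $ j\<bar>"
      and \<epsilon>y: "of_int (\<epsilon> j) * r * of_int (y $ j) = r * of_int (b j)" for j and r :: real
      by (simp_all add: \<epsilon>_def b_def)
    have "\<bar>s j\<bar> \<le> 1" for j
    proof -
      have "\<bar>real_of_int (\<epsilon> j)\<bar> = 1" by (simp add: \<epsilon>_def)
      then show ?thesis using s by (simp add: s_def abs_mult)
    qed
    moreover have "(\<Sum>j\<in>UNIV. s j * x $ j) = 3"
      unfolding sum_UNIV_4[OF i] s_eq \<epsilon>x by (rule sx)
    moreover have "(\<Sum>j\<in>UNIV. s j * y $ j) = 6 * real_of_int k"
      unfolding sum_UNIV_4[OF i] s_eq \<epsilon>y by (rule sy)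
    ultimately show ?thesis by blast
  qed
  have b_even: "even (b i1 + b i2 + b i3 + b i4)"
    using parity \<epsilon>(4) unfolding sum_UNIV_4[OF i] b_def by (simp add: even_mult_iff)
  have b_nz: "b j \<noteq> 0" if "\<bar>x $ j\<bar> = 0" for j
    using nz[of j] that by (auto simp: b_def \<epsilon>_def)
  have b_dist: "\<bar>y $ j - c * x $ j\<bar> = \<bar>b j - c * \<bar>x $ j\<bar>\<bar>" for j c
    by (auto simp: b_def \<epsilon>_def)
  have norm_x: "l1_norm x = \<bar>x $ i1\<bar> + \<bar>x $ i2\<bar> + \<bar>x $ i3\<bar> + \<bar>x $ i4\<bar>"
    by (simp add: l1_norm_def sum_UNIV_4[OF i])
  have norm_y: "l1_norm (y - c *s x) = \<bar>b i1 - c * \<bar>x $ i1\<bar>\<bar> + \<bar>b i2 - c * \<bar>x $ i2\<bar>\<bar>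
      + \<bar>b i3 - c * \<bar>x $ i3\<bar>\<bar> + \<bar>b i4 - c * \<bar>x $ i4\<bar>\<bar>" for c
    by (simp add: l1_norm_def sum_UNIV_4[OF i] b_dist)
  show ?thesis
    using norm
  proof (elim disjE conjE)
    assume "l1_norm x = 3"
    then consider "T = (3, 0, 0, 0)" | "T = (2, 1, 0, 0)" | "T = (1, 1, 1, 0)"
      using sorted_sum_3[OF sorted abs_ge_zero] unfolding norm_x T_def by blast
    then show ?thesis
    proof cases
      case 1
      note X = this[unfolded T_def prod.inject]
      show ?thesis
        by (rule from_slice, unfold 1, rule slice_3000) (use X b_nz in blast)+
    next
      case 2
      note X = this[unfolded T_def prod.inject]
      show ?thesis
        by (rule from_slice, unfold 2, rule slice_2100) (use X b_nz b_even in blast)+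
    next
      case 3
      note X = this[unfolded T_def prod.inject]
      show ?thesis
      proof (cases "\<bar>b i4\<bar> = 1 \<and> 3 dvd b i1 + b i2 + b i3")
        case True
        \<comment> \<open>An entry of absolute value 1 is its own sign.\<close>
        have "b j = x $ j * y $ j" if "\<bar>x $ j\<bar> = 1" for j
          using \<epsilon>(1)[of j] that by (simp add: b_def)
        then have "3 dvd x $ i1 * y $ i1 + x $ i2 * y $ i2 + x $ i3 * y $ i3"
          using True X by metis
        moreover have "\<bar>y $ i4\<bar> = 1"
          using True \<epsilon>(3)[of i4] by (simp add: b_def abs_mult)
        moreover have "x $ i4 = 0"
          using X by simp
        ultimately show ?thesis
          using X i by blast
      next
        case False
        show ?thesis
          by (rule from_slice, unfold 3, rule slice_1110) (use X b_nz b_even False in blast)+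
      qed
    qed
  next
    assume "l1_norm x = 5" and far: "\<forall>c. 5 \<le> l1_norm (y - c *s x)"
    then consider "T = (5, 0, 0, 0)" | "T = (4, 1, 0, 0)" | "T = (3, 2, 0, 0)"
      | "T = (3, 1, 1, 0)" | "T = (2, 2, 1, 0)" | "T = (2, 1, 1, 1)"
      using sorted_sum_5[OF sorted abs_ge_zero] unfolding norm_x T_def by blast
    then show ?thesis
    proof cases
      case 1
      note X = this[unfolded T_def prod.inject]
      show ?thesis
        by (rule from_slice, unfold 1, rule slice_5000) (use X b_nz in blast)+
    next
      case 2
      note X = this[unfolded T_def prod.inject]
      show ?thesis
        by (rule from_slice, unfold 2, rule slice_4100) (use X b_nz b_even in blast)+
    next
      case 3
      note X = this[unfolded T_def prod.inject]
      show ?thesis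
        by (rule from_slice, unfold 3, rule slice_3200) (use X b_nz b_even in blast)+
    next
      case 4
      note X = this[unfolded T_def prod.inject]
      \<comment> \<open>Such a \<open>c\<close> would give \<open>y - c *s x\<close> the norm
        \<open>\<bar>b i4\<bar>\<close>, which must be at least 5.\<close>
      have "\<bar>b i4\<bar> \<noteq> 1" if "(b i1 - c * 3, b i2 - c, b i3 - c) = (0, 0, 0)" for c
        using far[rule_format, of c] that unfolding norm_y by (simp add: X)
      then show ?thesis
        by (intro from_slice, unfold 4, intro slice_3110) (use X b_nz b_even in blast)+
    next
      case 5
      note X = this[unfolded T_def prod.inject]
      have "5 \<le> \<bar>b i1 - c * 2\<bar> + \<bar>b i2 - c * 2\<bar> + \<bar>b i3 - c\<bar> + \<bar>b i4\<bar>" for c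
        using far[rule_format, of c] unfolding norm_y by (simp add: X)
      then show ?thesis
        by (intro from_slice, unfold 5, intro slice_2210) (use X b_nz b_even in blast)+
    next
      case 6
      note X = this[unfolded T_def prod.inject]
      have "5 \<le> \<bar>b i1 - c * 2\<bar> + \<bar>b i2 - c\<bar> + \<bar>b i3 - c\<bar> + \<bar>b i4 - c\<bar>" for c
        using far[rule_format, of c] unfolding norm_y by (simp add: X)
      then show ?thesis
        by (intro from_slice, unfold 6, intro slice_2111) (use b_even in blast)+
    qed
  qed
qed

section \<open>Bases of the column lattice\<close>

text \<open>Encoded by coefficients of determinant 1 or -1, so the notion also makes sense when the
  columns of \<open>M\<close> are linearly dependent: \<open>x\<close> and \<open>y\<close> are then
  the images of a basis of the rank 2 lattice of coefficients.\<close>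

definition column_basis :: "int ^ 2 ^ 'm \<Rightarrow> int ^ 'm \<Rightarrow> int ^ 'm \<Rightarrow> bool" where
  "column_basis M x y \<longleftrightarrow> (\<exists>p q r s. (p * s - q * r = 1 \<or> p * s - q * r = - 1) \<and>
     x = p *s column 1 M + q *s column 2 M \<and> y = r *s column 1 M + s *s column 2 M)"

lemma column_basis_columns: "column_basis M (column 1 M) (column 2 M)"
  unfolding column_basis_def
  by (rule exI[of _ 1], rule exI[of _ 0], rule exI[of _ 0], rule exI[of _ 1]) simp

lemma column_basis_swap: "column_basis M x y \<Longrightarrow> column_basis M y x"
  unfolding column_basis_def
proof (elim exE conjE)
  fix p q r s :: int
  assume "p * s - q * r = 1 \<or> p * s - q * r = - 1"
    and "x = p *s column 1 M + q *s column 2 M" "y = r *s column 1 M + s *s column 2 M"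
  then show "\<exists>p q r s. (p * s - q * r = 1 \<or> p * s - q * r = - 1) \<and>
      y = p *s column 1 M + q *s column 2 M \<and> x = r *s column 1 M + s *s column 2 M"
    by (intro exI[of _ r] exI[of _ s] exI[of _ p] exI[of _ q]) (auto simp: algebra_simps)
qed

lemma column_basis_add_left:
  assumes "column_basis M x y"
  shows "column_basis M (x + k *s y) y"
proof -
  obtain p q r s where det: "p * s - q * r = 1 \<or> p * s - q * r = - 1"
    and xy: "x = p *s column 1 M + q *s column 2 M" "y = r *s column 1 M + s *s column 2 M"
    using assms unfolding column_basis_def by blast
  have "(p + k * r) * s - (q + k * s) * r = p * s - q * r"
    by (simp add: algebra_simps)
  moreover have "x + k *s y = (p + k * r) *s column 1 M + (q + k * s) *s column 2 M"
    by (simp add: xy vec_eq_iff algebra_simps)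
  ultimately show ?thesis
    unfolding column_basis_def using det xy by metis
qed

lemma column_basis_add_right:
  "column_basis M x y \<Longrightarrow> column_basis M x (y + k *s x)"
  using column_basis_add_left column_basis_swap by blast

lemma column_basis_mem:
  assumes "column_basis M x y"
  shows "x \<in> column_subgroup M"
  using assms column_subgroup_closed column_subgroup_scale unfolding column_basis_def by metis

lemma column_basis_invert:
  assumes "column_basis M x y"
  obtains p q r s where "column 1 M = p *s x + q *s y" "column 2 M = r *s x + s *s y"
proof -
  obtain p q r s where det: "p * s - q * r = 1 \<or> p * s - q * r = - 1"
    and xy: "x = p *s column 1 M + q *s column 2 M" "y = r *s column 1 M + s *s column 2 M"
    using assms unfolding column_basis_def by blast
  \<comment> \<open>The determinant \<open>d\<close> is its own inverse, so the inverse coefficient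
    matrix is \<open>d\<close> times the adjugate.\<close>
  define d where "d = p * s - q * r"
  have d: "d * d = 1" using det by (auto simp: d_def)
  have "(d * s) *s x + (- d * q) *s y = (d * d) *s column 1 M"
    by (simp add: xy d_def vec_eq_iff algebra_simps)
  moreover have "(- d * r) *s x + (d * p) *s y = (d * d) *s column 2 M"
    by (simp add: xy d_def vec_eq_iff algebra_simps)
  ultimately show ?thesis
    using that[of "d * s" "- d * q" "- d * r" "d * p"] d by simp
qed

lemma column_basis_character:
  assumes "column_basis M x y" "character t x \<in> \<int>" "character t y \<in> \<int>"
  shows "character t (column j M) \<in> \<int>"
proof -
  obtain p q r s where "column 1 M = p *s x + q *s y" "column 2 M = r *s x + s *s y"
    using column_basis_invert[OF assms(1)] .
  then show ?thesis
    using exhaust_2[of j] assms(2,3) by (auto simp: character_simps)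
qed

lemma column_basis_nonzero_row:
  assumes "column_basis M x y" "row i M \<noteq> 0"
  shows "x $ i \<noteq> 0 \<or> y $ i \<noteq> 0"
proof (rule ccontr)
  assume zero: "\<not> (x $ i \<noteq> 0 \<or> y $ i \<noteq> 0)"
  obtain p q r s where "column 1 M = p *s x + q *s y" "column 2 M = r *s x + s *s y"
    using column_basis_invert[OF assms(1)] .
  then have "column 1 M $ i = 0" "column 2 M $ i = 0"
    using zero by simp_all
  then have "row i M = 0"
    by (simp add: vec_eq_iff forall_2 row_def column_def)
  then show False using assms(2) by simp
qed

lemma column_matrix_mult_2:
  fixes M :: "int ^ 2 ^ 'm"
  shows "column l (M ** U) = U $ 1 $ l *s column 1 M + U $ 2 $ l *s column 2 M"
  by (simp add: vec_eq_iff column_def matrix_matrix_mult_def sum_2 mult.commute)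

lemma column_basis_iff_unimodular:
  fixes M :: "int ^ 2 ^ 'm"
  shows "column_basis M x y \<longleftrightarrow>
    (\<exists>U. unimodular U \<and> x = column 1 (M ** U) \<and> y = column 2 (M ** U))" (is "_ \<longleftrightarrow> ?R")
proof
  assume "column_basis M x y"
  then obtain p q r s where det: "p * s - q * r = 1 \<or> p * s - q * r = - 1"
    and xy: "x = p *s column 1 M + q *s column 2 M" "y = r *s column 1 M + s *s column 2 M"
    unfolding column_basis_def by blast
  define U :: "int ^ 2 ^ 2" where "U = vector [vector [p, r], vector [q, s]]"
  have "unimodular U"
    using det by (simp add: unimodular_def det_2 U_def vector_2 mult.commute)
  moreover have "x = column 1 (M ** U)" "y = column 2 (M ** U)"
    by (simp_all add: column_matrix_mult_2 xy U_def vector_2)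
  ultimately show ?R by blast
next
  assume ?R
  then obtain U where U: "unimodular U" "x = column 1 (M ** U)" "y = column 2 (M ** U)"
    by blast
  then show "column_basis M x y"
    unfolding column_basis_def unimodular_def det_2 column_matrix_mult_2
    by (intro exI[of _ "U $ 1 $ 1"] exI[of _ "U $ 2 $ 1"] exI[of _ "U $ 1 $ 2"] exI[of _ "U $ 2 $ 2"])
      (auto simp: mult.commute)
qed

section \<open>Minimal pairs and the dichotomy between a 3-coloring and the exceptional form\<close>

lemma add_scale_minus: "z + (- k) *s w = z - k *s (w :: 'a::ring_1 ^ 'n)"
  by (simp add: vec_eq_iff)

lemma l1_norm_eq_1:
  assumes "l1_norm x = 1"
  obtains i where "x = axis i 1 \<or> x = - axis i 1"
proof -
  have "x \<noteq> 0"
    using assms by (auto simp: l1_norm_def)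
  then obtain i where i: "x $ i \<noteq> 0"
    by (auto simp: vec_eq_iff)
  have "l1_norm x = \<bar>x $ i\<bar> + (\<Sum>j\<in>UNIV - {i}. \<bar>x $ j\<bar>)"
    by (simp add: l1_norm_def sum.remove)
  moreover have "0 \<le> (\<Sum>j\<in>UNIV - {i}. \<bar>x $ j\<bar>)"
    by (simp add: sum_nonneg)
  ultimately have xi: "\<bar>x $ i\<bar> = 1" and others: "(\<Sum>j\<in>UNIV - {i}. \<bar>x $ j\<bar>) = 0"
    using i assms by linarith+
  have "\<forall>j\<in>UNIV - {i}. \<bar>x $ j\<bar> = 0"
    by (rule iffD1[OF sum_nonneg_eq_0_iff others]) auto
  then have "x = axis i (x $ i)"
    by (auto simp: vec_eq_iff axis_def)
  moreover have "axis i (- 1) = - axis i (1 :: int)"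
    by (simp add: vec_eq_iff axis_def)
  ultimately show ?thesis
    using that[of i] xi by (metis abs_eq_iff' abs_1 abs_minus_cancel abs_if)
qed

lemma character_or_tomato_cage:
  fixes M :: "int ^ 2 ^ 4"
  assumes "\<not> bipartite (SACG M)" "\<not> has_loop (SACG M)" and rows: "\<forall>i. row i M \<noteq> 0"
  obtains
    (coloring) t where "\<And>i. 1 / 3 \<le> t i" "\<And>i. t i \<le> 2 / 3" "\<And>j. character t (column j M) \<in> \<int>"
  | (tomato_cage) x y i1 i2 i3 i4 where "column_basis M x y"
      "distinct [i1, i2, i3, i4]" "UNIV = {i1, i2, i3, i4}"
      "\<bar>x $ i1\<bar> = 1" "\<bar>x $ i2\<bar> = 1" "\<bar>x $ i3\<bar> = 1" "x $ i4 = 0" "\<bar>y $ i4\<bar> = 1"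
      "3 dvd x $ i1 * y $ i1 + x $ i2 * y $ i2 + x $ i3 * y $ i3"
proof -
  define ev where "ev x = even (\<Sum>i\<in>UNIV. x $ i)" for x :: "int ^ 4"
  have ev_simps: "ev (x + y) \<longleftrightarrow> (ev x \<longleftrightarrow> ev y)" "ev (x - y) \<longleftrightarrow> (ev x \<longleftrightarrow> ev y)"
    "ev (k *s x) \<longleftrightarrow> even k \<or> ev x" for x y k
    by (simp_all add: ev_def sum.distrib sum_subtractf sum_distrib_left[symmetric])
  define P where "P x y \<longleftrightarrow> column_basis M x y \<and> \<not> ev x \<and> ev y" for x y
  have "\<exists>x y. P x y"
  \<comment> \<open>Nonbipartiteness provides a column with odd sum. If both columns are odd, adding
    the first to the second makes the second even.\<close>
  proof -
    obtain j where "\<not> ev (column j M)"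
      using bipartite_SACG assms(1) unfolding ev_def by blast
    then have "\<not> ev (column 1 M) \<or> \<not> ev (column 2 M)"
      using exhaust_2[of j] by auto
    moreover have "column_basis M (column 1 M) (column 2 M)" "column_basis M (column 2 M) (column 1 M)"
      "column_basis M (column 1 M) (column 2 M + 1 *s column 1 M)"
      using column_basis_columns column_basis_swap column_basis_add_right by blast+
    moreover have "ev (column 2 M + 1 *s column 1 M) \<longleftrightarrow> (ev (column 2 M) \<longleftrightarrow> ev (column 1 M))"
      by (simp add: ev_simps)
    ultimately show ?thesis
      unfolding P_def by metis
  qed
  \<comment> \<open>The norm of \<open>x\<close> is minimized over all admissible pairs first, that
    of \<open>y\<close> afterwards among the partners of this \<open>x\<close>.\<close>
  then obtain x where x: "\<exists>y. P x y" and x_min: "\<And>x' y'. P x' y' \<Longrightarrow> nat (l1_norm x) \<le> nat (l1_norm x')"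
    using ex_has_least_nat[of "\<lambda>x. \<exists>y. P x y" _ "\<lambda>x. nat (l1_norm x)"] by metis
  then obtain y where y: "P x y" and y_min: "\<And>y'. P x y' \<Longrightarrow> nat (l1_norm y) \<le> nat (l1_norm y')"
    using ex_has_least_nat[of "P x" _ "\<lambda>y. nat (l1_norm y)"] by metis
  have x_le: "l1_norm x \<le> l1_norm x'" if "P x' y'" for x' y'
    using x_min[OF that] l1_norm_nonneg[of x'] by linarith
  have y_le: "l1_norm y \<le> l1_norm y'" if "P x y'" for y'
    using y_min[OF that] l1_norm_nonneg[of y'] by linarith
  have basis: "column_basis M x y" and x_odd: "\<not> ev x" and y_even: "ev y"
    using y by (auto simp: P_def)
  have P_left: "P (x + k *s y) y" for k
    using y column_basis_add_left by (auto simp: P_def ev_simps)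
  have P_right: "P x (y + k *s x)" if "even k" for k
    using y that column_basis_add_right by (auto simp: P_def ev_simps)
  \<comment> \<open>For odd \<open>k\<close> the vector \<open>y + k *s x\<close> is odd and starts
    another admissible pair, so minimality of \<open>x\<close> bounds its norm. Even multiples are
    covered by minimality of \<open>y\<close>.\<close>
  have P_swap: "P (y + k *s x) (x + 1 *s (y + k *s x))" if "odd k" for k
  proof -
    have "column_basis M (y + k *s x) (x + 1 *s (y + k *s x))"
      using basis by (intro column_basis_add_right column_basis_swap[OF column_basis_add_right])
    then show ?thesis
      using x_odd y_even that unfolding P_def ev_simps by simp
  qed
  have red: "l1_norm x \<le> l1_norm (x + y)" "l1_norm x \<le> l1_norm (x - y)"
    "l1_norm y \<le> l1_norm (y + 2 *s x)" "l1_norm y \<le> l1_norm (y - 2 *s x)"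
    using x_le[OF P_left[of 1]] x_le[OF P_left[of "- 1"]] y_le[OF P_right[of 2]] y_le[OF P_right[of "- 2"]]
    by (simp_all add: add_scale_minus)
  have "odd (l1_norm x)"
    using x_odd by (simp add: even_l1_norm ev_def)
  have "l1_norm x \<noteq> 1"
    using l1_norm_eq_1 column_basis_mem[OF basis] has_loop_SACG assms(2) by metis
  have far: "5 \<le> l1_norm (y - c *s x)" if "l1_norm x = 5" "5 \<le> l1_norm y" for c
  proof (cases "even c")
    case True
    then show ?thesis using y_le[OF P_right[of "- c"]] that by (simp add: add_scale_minus)
  next
    case False
    then show ?thesis using x_le[OF P_swap[of "- c"]] that by (simp add: add_scale_minus)
  qed
  have solve: thesis
    if s: "\<And>i. \<bar>s i\<bar> \<le> 1" "(\<Sum>i\<in>UNIV. s i * x $ i) = 3" "(\<Sum>i\<in>UNIV. s i * y $ i) = 6 * of_int k"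
    for s :: "4 \<Rightarrow> real" and k :: int
  proof -
    \<comment> \<open>The cube for \<open>s\<close> becomes the cube with sides from
      \<open>1 / 3\<close> to \<open>2 / 3\<close>. On \<open>x\<close> the form is half an odd
      number plus \<open>3 / 6\<close>, on \<open>y\<close> half an even number plus
      \<open>k\<close>; both are integers.\<close>
    define t where "t i = 1 / 2 + s i / 6" for i
    have t: "character t z = of_int (\<Sum>i\<in>UNIV. z $ i) / 2 + (\<Sum>i\<in>UNIV. s i * z $ i) / 6" for z
      by (simp add: character_def t_def distrib_right sum.distrib sum_divide_distrib)
    have "1 / 3 \<le> t i" "t i \<le> 2 / 3" for i
      using s(1)[of i] by (auto simp: t_def abs_le_iff)
    moreover have "character t x \<in> \<int>"
    proof -
      obtain n where "(\<Sum>i\<in>UNIV. x $ i) = 2 * n + 1"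
        using x_odd unfolding ev_def by (blast elim: oddE)
      then have "character t x = of_int (n + 1)"
        unfolding t s(2) by (simp add: add_divide_distrib)
      then show ?thesis by simp
    qed
    moreover have "character t y \<in> \<int>"
    proof -
      obtain n where "(\<Sum>i\<in>UNIV. y $ i) = 2 * n"
        using y_even unfolding ev_def by (blast elim: evenE)
      then have "character t y = of_int (n + k)"
        unfolding t s(3) by (simp add: add_divide_distrib)
      then show ?thesis by simp
    qed
    ultimately show ?thesis
      using coloring column_basis_character[OF basis] by blast
  qed
  show thesis
  proof (cases "7 \<le> l1_norm x \<or> l1_norm x = 5 \<and> l1_norm y < 5")
    case True
    \<comment> \<open>A norm of at least 7 is halved to more than 3; for norm 5 the partner has norm
      at most 4, which leaves \<open>5 - 4 / 2 = 3\<close>.\<close>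
    have "3 \<le> (\<Sum>i\<in>UNIV. \<bar>x $ i + u * y $ i\<bar>)" for u :: real
      using reduced_pair_bound[OF red, of u] True by linarith
    from zonotope_contains_on_axis[OF _ this] show ?thesis
      using solve[of _ 0] by auto
  next
    case False
    have "l1_norm x = 3 \<or> l1_norm x = 5 \<or> 7 \<le> l1_norm x"
      using \<open>odd (l1_norm x)\<close> \<open>l1_norm x \<noteq> 1\<close> l1_norm_nonneg[of x] by presburger
    then have norm: "l1_norm x = 3 \<or> l1_norm x = 5 \<and> (\<forall>c. 5 \<le> l1_norm (y - c *s x))"
      using False far by auto
    have "x $ i \<noteq> 0 \<or> y $ i \<noteq> 0" for i
      using column_basis_nonzero_row[OF basis] rows by blast
    note dichotomy = slice_or_tomato_cage[OF this y_even[unfolded ev_def] norm]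
    from dichotomy show ?thesis
    proof (elim disjE exE conjE)
      fix s :: "4 \<Rightarrow> real" and k :: int
      assume "\<forall>i. \<bar>s i\<bar> \<le> 1" "(\<Sum>i\<in>UNIV. s i * x $ i) = 3" "(\<Sum>i\<in>UNIV. s i * y $ i) = 6 * real_of_int k"
      then show ?thesis using solve by blast
    next
      fix i1 i2 i3 i4
      assume "distinct [i1, i2, i3, i4]" "UNIV = {i1, i2, i3, i4}"
        "\<bar>x $ i1\<bar> = 1" "\<bar>x $ i2\<bar> = 1" "\<bar>x $ i3\<bar> = 1" "x $ i4 = 0" "\<bar>y $ i4\<bar> = 1"
        "3 dvd x $ i1 * y $ i1 + x $ i2 * y $ i2 + x $ i3 * y $ i3"
      then show ?thesis by (rule tomato_cage[OF basis])
    qed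
  qed
qed

section \<open>The exceptional matrices\<close>

text \<open>Triangles with edges \<open>E\<^sub>1, E\<^sub>2, E\<^sub>3\<close> force the three generators to act on the colors in the same way.\<close>

lemma three_coloring_period:
  fixes g :: "int ^ 'm \<Rightarrow> nat"
  assumes range: "\<And>x. g x < 3"
    and E: "\<And>x. g (x + E\<^sub>1) \<noteq> g x" "\<And>x. g (x + E\<^sub>2) \<noteq> g x" "\<And>x. g (x + E\<^sub>3) \<noteq> g x"
    and triangle: "\<And>x. g (x + (E\<^sub>1 + E\<^sub>2 + E\<^sub>3)) = g x"
    and "3 dvd a + b + c"
  shows "g (x + (a *s E\<^sub>1 + b *s E\<^sub>2 + c *s E\<^sub>3)) = g x"
proof -
  define per where "per = {p. \<forall>x. g (x + p) = g x}"
  have zero: "0 \<in> per"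
    by (simp add: per_def)
  have add: "p + q \<in> per" if "p \<in> per" "q \<in> per" for p q
    using that by (simp add: per_def add.assoc[symmetric])
  have uminus: "- p \<in> per" if "p \<in> per" for p
  proof -
    have "g (x - p + p) = g (x - p)" for x
      using that unfolding per_def by blast
    then show ?thesis by (simp add: per_def)
  qed
  have scale: "k *s p \<in> per" if "p \<in> per" for k p
    using zero add uminus that by (rule int_multiple_closed)
  have swap: "A - B \<in> per"
    if A: "\<And>x. g (x + A) \<noteq> g x" and B: "\<And>x. g (x + B) \<noteq> g x" and C: "\<And>x. g (x + C) \<noteq> g x"
      and ABC: "\<And>x. g (x + (A + B + C)) = g x" for A B C
  proof -
    have "g (x + A) = g (x + B)" for x
    proof -
      \<comment> \<open>A further step by \<open>C\<close> returns to the color of \<open>x\<close>.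
        Thus \<open>x\<close> and \<open>x + (A + B)\<close> have two different colors, and
        \<open>x + A\<close> and \<open>x + B\<close> avoid both, which leaves them the same third
        color.\<close>
      have "g (x + (A + B)) \<noteq> g x"
        using C[of "x + (A + B)"] ABC[of x] by (simp add: add.assoc)
      moreover have "g (x + (A + B)) \<noteq> g (x + A)" "g (x + (A + B)) \<noteq> g (x + B)"
        using B[of "x + A"] A[of "x + B"] by (simp_all add: ac_simps)
      moreover have "g (x + A) \<noteq> g x" "g (x + B) \<noteq> g x"
        using A B by auto
      ultimately show ?thesis
        using range[of x] range[of "x + A"] range[of "x + B"] range[of "x + (A + B)"] by linarith
    qed
    from this[of "_ - B"] show ?thesis
      by (simp add: per_def algebra_simps)
  qed
  have 12: "E\<^sub>1 - E\<^sub>2 \<in> per"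
    by (rule swap[OF E]) (rule triangle)
  have 13: "E\<^sub>1 - E\<^sub>3 \<in> per"
    by (rule swap[OF E(1,3,2)]) (use triangle in \<open>simp add: ac_simps\<close>)
  have "E\<^sub>1 + E\<^sub>2 + E\<^sub>3 \<in> per"
    using triangle by (simp add: per_def)
  then have "(E\<^sub>1 + E\<^sub>2 + E\<^sub>3) + (E\<^sub>1 - E\<^sub>2) + (E\<^sub>1 - E\<^sub>3) \<in> per"
    using 12 13 add by blast
  also have "(E\<^sub>1 + E\<^sub>2 + E\<^sub>3) + (E\<^sub>1 - E\<^sub>2) + (E\<^sub>1 - E\<^sub>3) = 3 *s E\<^sub>1"
    by (simp add: vec_eq_iff)
  finally have 3: "3 *s E\<^sub>1 \<in> per" .
  obtain m where m: "a + b + c = 3 * m"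
    using assms(6) by blast
  \<comment> \<open>The target is \<open>(a + b + c) *s E\<^sub>1\<close> corrected by multiples of
    the two difference periods, and 3 divides \<open>a + b + c\<close>.\<close>
  have "m *s (3 *s E\<^sub>1) + (- b) *s (E\<^sub>1 - E\<^sub>2) + (- c) *s (E\<^sub>1 - E\<^sub>3) \<in> per"
    using scale[OF 3] scale[OF 12] scale[OF 13] add by blast
  also have "m *s (3 *s E\<^sub>1) + (- b) *s (E\<^sub>1 - E\<^sub>2) + (- c) *s (E\<^sub>1 - E\<^sub>3)
      = (3 * m - b - c) *s E\<^sub>1 + b *s E\<^sub>2 + c *s E\<^sub>3"
    by (simp add: vec_eq_iff algebra_simps)
  also have "3 * m - b - c = a"
    using m by simp
  finally show ?thesis
    by (simp add: per_def)
qed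

text \<open>The triples with entries \<open>1 / 2\<close>, \<open>1 / 4\<close>,
  \<open>1 / 4\<close> in some order have sum 1 and leave a remainder \<open>v / 4\<close>, which a
  suitable \<open>t4\<close> completes unless 4 divides \<open>v\<close>. If this fails for all
  three orders, \<open>a - b\<close> and \<open>a - c\<close> are multiples of 4, not both 0;
  tilting the triple with all entries \<open>1 / 3\<close> then works with
  \<open>t4 = 3 / 4\<close>.\<close>

lemma quarter_solution:
  fixes a b c :: int
  assumes "3 dvd a + b + c" "\<not> (a = b \<and> a = c)"
  shows "\<exists>(t1 :: real) (t2 :: real) (t3 :: real) (t4 :: real). {t1, t2, t3, t4} \<subseteq> {1 / 4..3 / 4} \<and>
    t1 + t2 + t3 \<in> \<int> \<and> a * t1 + b * t2 + c * t3 + t4 \<in> \<int>"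
proof -
  have mod4: "\<exists>t4\<in>{1 / 4..3 / 4}. real_of_int v / 4 + t4 \<in> \<int>" if "\<not> 4 dvd v" for v :: int
  proof -
    define r where "r = v mod 4"
    have r: "1 \<le> r" "r \<le> 3"
      using that unfolding r_def by presburger+
    have "real_of_int v / 4 + (1 - r / 4) = of_int (v div 4 + 1)"
    proof -
      have "v = 4 * (v div 4) + r" by (simp add: r_def)
      then have "real_of_int v = 4 * of_int (v div 4) + of_int r"
        by (metis of_int_add of_int_mult of_int_numeral)
      then show ?thesis by (simp add: add_divide_distrib)
    qed
    then have "real_of_int v / 4 + (1 - r / 4) \<in> \<int>"
      by (metis Ints_of_int)
    moreover have "1 - real_of_int r / 4 \<in> {1 / 4..3 / 4}"
      using r by auto
    ultimately show ?thesis by blast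
  qed
  obtain m where m: "a + b + c = 3 * m"
    using assms(1) by blast
  \<comment> \<open>The margin \<open>1 / 12\<close> is \<open>1 / 3 - 1 / 4\<close>, and a shift of
    \<open>1 / 4\<close> completes \<open>3 / 4\<close> to an integer.\<close>
  have tilt: "\<exists>u :: real. \<bar>u\<bar> \<le> 1 / 12 \<and> d * u = 1 / 4" if "d \<noteq> 0" "4 dvd d" for d :: int
  proof (intro exI[of _ "1 / (4 * real_of_int d)"] conjI)
    have "4 \<le> \<bar>d\<bar>" using that by presburger
    then have "4 \<le> \<bar>real_of_int d\<bar>" by linarith
    then show "\<bar>1 / (4 * real_of_int d)\<bar> \<le> 1 / 12"
      by (simp add: abs_mult divide_simps)
    show "d * (1 / (4 * real_of_int d)) = 1 / 4"
      using that by simp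
  qed
  have third: "of_int (a + b + c) / 3 = real_of_int m"
    unfolding m by simp
  have diffs: "(2 * a + b + c) - (a + b + 2 * c) = a - c" "(2 * a + b + c) - (a + 2 * b + c) = a - b"
    by simp_all
  consider "\<not> 4 dvd 2 * a + b + c" | "\<not> 4 dvd a + 2 * b + c" | "\<not> 4 dvd a + b + 2 * c"
    | "a \<noteq> c" "4 dvd a - c" | "a \<noteq> b" "4 dvd a - b"
    using assms(2) dvd_diff[of 4 "2 * a + b + c"] diffs by metis
  then show ?thesis
  proof cases
    case 1
    then obtain t4 where "t4 \<in> {1 / 4..3 / 4}" "real_of_int (2 * a + b + c) / 4 + t4 \<in> \<int>"
      using mod4 by blast
    then show ?thesis
      by (intro exI[of _ "1 / 2"] exI[of _ "1 / 4"] exI[of _ "1 / 4"] exI[of _ t4])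
        (auto simp: field_simps)
  next
    case 2
    then obtain t4 where "t4 \<in> {1 / 4..3 / 4}" "real_of_int (a + 2 * b + c) / 4 + t4 \<in> \<int>"
      using mod4 by blast
    then show ?thesis
      by (intro exI[of _ "1 / 4"] exI[of _ "1 / 2"] exI[of _ "1 / 4"] exI[of _ t4])
        (auto simp: field_simps)
  next
    case 3
    then obtain t4 where "t4 \<in> {1 / 4..3 / 4}" "real_of_int (a + b + 2 * c) / 4 + t4 \<in> \<int>"
      using mod4 by blast
    then show ?thesis
      by (intro exI[of _ "1 / 4"] exI[of _ "1 / 4"] exI[of _ "1 / 2"] exI[of _ t4])
        (auto simp: field_simps)
  next
    case 4
    then obtain u where u: "\<bar>u\<bar> \<le> 1 / 12" "real_of_int (a - c) * u = 1 / 4"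
      using tilt[of "a - c"] by auto
    have "a * (1 / 3 + u) + b * (1 / 3) + c * (1 / 3 - u) + 3 / 4 = of_int (m + 1)"
      using u(2) third by (simp add: algebra_simps)
    then have "a * (1 / 3 + u) + b * (1 / 3) + c * (1 / 3 - u) + 3 / 4 \<in> \<int>"
      by (metis Ints_of_int)
    then show ?thesis
      using u(1) by (intro exI[of _ "1 / 3 + u"] exI[of _ "1 / 3"] exI[of _ "1 / 3 - u"] exI[of _ "3 / 4"])
        (auto simp: abs_le_iff)
  next
    case 5
    then obtain u where u: "\<bar>u\<bar> \<le> 1 / 12" "real_of_int (a - b) * u = 1 / 4"
      using tilt[of "a - b"] by auto
    have "a * (1 / 3 + u) + b * (1 / 3 - u) + c * (1 / 3) + 3 / 4 = of_int (m + 1)"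
      using u(2) third by (simp add: algebra_simps)
    then have "a * (1 / 3 + u) + b * (1 / 3 - u) + c * (1 / 3) + 3 / 4 \<in> \<int>"
      by (metis Ints_of_int)
    then show ?thesis
      using u(1) by (intro exI[of _ "1 / 3 + u"] exI[of _ "1 / 3 - u"] exI[of _ "1 / 3"] exI[of _ "3 / 4"])
        (auto simp: abs_le_iff)
  qed
qed

section \<open>Signed permutation matrices and the chromatic number in the exceptional case\<close>

lemma signed_permutationE:
  fixes P :: "int ^ 'n ^ 'n"
  assumes "signed_permutation_matrix P"
  obtains \<sigma> :: "'n \<Rightarrow> 'n" and \<epsilon> :: "'n \<Rightarrow> int"
  where "bij \<sigma>" "\<And>k. \<epsilon> k = 1 \<or> \<epsilon> k = - 1" "P = (\<chi> k j. if j = \<sigma> k then \<epsilon> k else 0)"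
proof -
  define \<sigma> where "\<sigma> k = (THE j. P $ k $ j \<noteq> 0)" for k
  note signed = assms[unfolded signed_permutation_matrix_def]
  have rows: "\<exists>!j. P $ k $ j \<noteq> 0" for k
    using signed by (elim conjE) (erule spec)
  have cols: "\<exists>!i. P $ i $ k \<noteq> 0" for k
    using signed by (elim conjE) (erule spec)
  have entries: "P $ k $ j = 1 \<or> P $ k $ j = - 1" if "P $ k $ j \<noteq> 0" for k j
    using signed that by simp
  have nz: "P $ k $ \<sigma> k \<noteq> 0" for k
    unfolding \<sigma>_def using rows by (rule theI')
  then have nz_iff: "P $ k $ j \<noteq> 0 \<longleftrightarrow> j = \<sigma> k" for k j
    using rows by metis
  have "inj \<sigma>"
    using cols nz by (metis injI)
  then have "bij \<sigma>"
    using finite_UNIV_inj_surj[of \<sigma>] by (simp add: bij_def)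
  moreover have "P = (\<chi> k j. if j = \<sigma> k then P $ k $ \<sigma> k else 0)"
    using nz_iff by (auto simp: vec_eq_iff)
  ultimately show ?thesis
    using that[of \<sigma> "\<lambda>k. P $ k $ \<sigma> k"] entries nz by metis
qed

lemma signed_permutationI:
  fixes \<sigma> :: "'n::finite \<Rightarrow> 'n" and \<epsilon> :: "'n \<Rightarrow> int"
  assumes "inj \<sigma>" "\<And>k. \<epsilon> k = 1 \<or> \<epsilon> k = - 1"
  shows "signed_permutation_matrix (\<chi> k j. if j = \<sigma> k then \<epsilon> k else 0)"
proof -
  have "surj \<sigma>" using assms(1) by (simp add: finite_UNIV_inj_surj)
  moreover have "\<epsilon> k \<noteq> 0" for k using assms(2)[of k] by auto
  ultimately show ?thesis
    unfolding signed_permutation_matrix_def using assms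
    by (auto simp: inj_def split: if_splits; metis surjD)
qed

lemma signed_permutation_mult:
  fixes \<sigma> :: "'n::finite \<Rightarrow> 'n" and \<epsilon> :: "'n \<Rightarrow> int"
  shows "((\<chi> k j. if j = \<sigma> k then \<epsilon> k else 0) ** A) $ k $ l = \<epsilon> k * A $ \<sigma> k $ l"
  by (simp add: matrix_matrix_mult_def if_distrib[of "\<lambda>z. z * _"] cong: if_cong)

lemma tomato_cage_chromatic_number:
  fixes M :: "int ^ 2 ^ 4" and P :: "int ^ 4 ^ 4" and U :: "int ^ 2 ^ 2"
  assumes no_loop: "\<not> has_loop (SACG M)"
    and P: "signed_permutation_matrix P" and U: "unimodular U" and abc: "3 dvd a + b + c"
    and PMU: "P ** M ** U = vector [vector [1, a], vector [1, b], vector [1, c], vector [0, 1]]"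
  shows "chromatic_number (SACG M) = 4"
proof -
  obtain \<sigma> :: "4 \<Rightarrow> 4" and \<epsilon> :: "4 \<Rightarrow> int" where \<sigma>: "bij \<sigma>"
    and \<epsilon>: "\<And>k. \<epsilon> k = 1 \<or> \<epsilon> k = - 1" and P_eq: "P = (\<chi> k j. if j = \<sigma> k then \<epsilon> k else 0)"
    using signed_permutationE[OF P] by blast
  define x y where "x = column 1 (M ** U)" and "y = column 2 (M ** U)"
  have basis: "column_basis M x y"
    unfolding column_basis_iff_unimodular x_def y_def using U by blast
  \<comment> \<open>In the signed generators \<open>E\<close> the basis reads off the displayed
    matrix: \<open>x = E 1 + E 2 + E 3\<close>, and \<open>y\<close> has coefficients
    \<open>a\<close>, \<open>b\<close>, \<open>c\<close>, 1.\<close>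
  define E where "E k = \<epsilon> k *s axis (\<sigma> k) (1 :: int)" for k
  have E_cases: "\<epsilon> k = 1 \<and> E k = axis (\<sigma> k) 1 \<or> \<epsilon> k = - 1 \<and> E k = - axis (\<sigma> k) 1" for k
    using \<epsilon>[of k] by (auto simp: E_def vec_eq_iff)
  have \<epsilon>\<epsilon>: "\<epsilon> k * \<epsilon> k = 1" for k
    using \<epsilon>[of k] by auto
  have entry: "(P ** M ** U) $ k $ l = \<epsilon> k * (M ** U) $ \<sigma> k $ l" for k l
    unfolding P_eq matrix_mul_assoc[symmetric] by (rule signed_permutation_mult)
  have col: "column l (M ** U) = (\<Sum>k\<in>UNIV. (P ** M ** U) $ k $ l *s E k)" for l
  proof (subst vec_eq_iff, intro allI)
    fix j
    obtain k' where j: "j = \<sigma> k'"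
      using \<sigma> by (metis bij_pointE)
    have "(\<Sum>k\<in>UNIV. (P ** M ** U) $ k $ l *s E k) $ j
        = (\<Sum>k\<in>UNIV. if k = k' then (P ** M ** U) $ k $ l * \<epsilon> k else 0)"
      unfolding sum_component
      using \<sigma> by (intro sum.cong) (auto simp: E_def axis_def j bij_def inj_eq)
    also have "\<dots> = (\<epsilon> k' * \<epsilon> k') * (M ** U) $ \<sigma> k' $ l"
      by (simp add: entry algebra_simps)
    finally show "column l (M ** U) $ j = (\<Sum>k\<in>UNIV. (P ** M ** U) $ k $ l *s E k) $ j"
      by (simp add: \<epsilon>\<epsilon> column_def j)
  qed
  have x: "x = E 1 + E 2 + E 3" and y: "y = a *s E 1 + b *s E 2 + c *s E 3 + E 4"
    unfolding x_def y_def col PMU by (simp_all add: sum_4 vector_def)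
  \<comment> \<open>Otherwise \<open>y - a *s x\<close> would be the generator \<open>E 4\<close>, a
    loop.\<close>
  have "\<not> (a = b \<and> a = c)"
  proof
    assume "a = b \<and> a = c"
    then have "y - a *s x = E 4"
      unfolding x y by (simp add: vec_eq_iff algebra_simps)
    moreover have "y - a *s x \<in> column_subgroup M"
      using column_basis_mem[OF column_basis_swap[OF column_basis_add_right[OF basis, of "- a"]]]
      by (simp add: add_scale_minus)
    ultimately show False
      using has_loop_SACG[of "\<sigma> 4" M] E_cases[of 4] no_loop by auto
  qed
  then obtain t1 t2 t3 t4 :: real where t: "{t1, t2, t3, t4} \<subseteq> {1 / 4..3 / 4}"
    and tx: "t1 + t2 + t3 \<in> \<int>" and ty: "a * t1 + b * t2 + c * t3 + t4 \<in> \<int>"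
    using quarter_solution[OF abc] by blast
  define \<tau> :: "4 \<Rightarrow> real" where "\<tau> k = (if k = 1 then t1 else if k = 2 then t2 else if k = 3 then t3 else t4)" for k
  have \<tau>: "1 / 4 \<le> \<tau> k \<and> \<tau> k \<le> 3 / 4" for k
    using t by (auto simp: \<tau>_def)
  \<comment> \<open>For a negated generator the coordinate is \<open>1 - \<tau> k\<close>: it
    differs from \<open>- \<tau> k\<close> by an integer, recorded in \<open>n\<close>, and stays
    between \<open>1 / 4\<close> and \<open>3 / 4\<close>.\<close>
  define t where "t i = (let k = inv_into UNIV \<sigma> i in if \<epsilon> k = 1 then \<tau> k else 1 - \<tau> k)" for i
  define n where "n k = (if \<epsilon> k = 1 then 0 else - 1 :: int)" for k
  have tE: "character t (E k) = \<tau> k + of_int (n k)" for k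
    using E_cases[of k] \<sigma> by (auto simp: character_simps t_def n_def bij_def)
  have "character t x = (t1 + t2 + t3) + of_int (n 1 + n 2 + n 3)"
    unfolding x character_simps tE by (simp add: \<tau>_def)
  then have "character t x \<in> \<int>"
    using tx by simp
  moreover have "character t y = (a * t1 + b * t2 + c * t3 + t4) + of_int (a * n 1 + b * n 2 + c * n 3 + n 4)"
    unfolding y character_simps tE by (simp add: \<tau>_def algebra_simps)
  then have "character t y \<in> \<int>"
    using ty by simp
  ultimately have "chromatic_number (SACG M) \<le> enat 4"
    using \<tau> by (intro chromatic_number_le_by_character[of 4 t] column_basis_character[OF basis])
      (auto simp: t_def Let_def)
  moreover have "\<not> chromatic_number (SACG M) \<le> enat 3"
  proof
    assume "chromatic_number (SACG M) \<le> enat 3"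
    then obtain f :: "_ \<Rightarrow> nat" where f: "f ` pverts (SACG M) \<subseteq> {..<3}" "proper_coloring (SACG M) f"
      unfolding chromatic_number_le_iff by blast
    define g where "g z = f (SACG_vertex M z)" for z
    have g_period: "g (z + h) = g z" if "h \<in> column_subgroup M" for z h
      using that SACG_vertex_eq_iff[of M "z + h" z] by (simp add: g_def)
    have g_less: "g z < 3" for z
      using f(1) by (auto simp: g_def pverts_SACG)
    have g_axis: "g z \<noteq> g (z + axis i 1)" for z i
      using f(2) unfolding g_def proper_coloring_SACG_iff by blast
    have gE: "g (z + E k) \<noteq> g z" for z k
      using E_cases[of k] g_axis[of z "\<sigma> k"] g_axis[of "z - axis (\<sigma> k) 1" "\<sigma> k"]
      by auto
    have "g (z + (E 1 + E 2 + E 3)) = g z" for z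
      using g_period column_basis_mem[OF basis] by (simp add: x)
    \<comment> \<open>The combination of \<open>E 1\<close>, \<open>E 2\<close>, \<open>E 3\<close>
      is a period of \<open>g\<close>, and adding \<open>E 4\<close> to it gives \<open>y\<close>, a
      period as well. So \<open>E 4\<close> would have the color of its neighbor 0.\<close>
    then have "g (E 4 + (a *s E 1 + b *s E 2 + c *s E 3)) = g (E 4)"
      using g_less gE abc by (intro three_coloring_period)
    moreover have "E 4 + (a *s E 1 + b *s E 2 + c *s E 3) = 0 + y"
      by (simp add: y add.commute)
    moreover have "g (0 + y) = g 0"
      using column_basis_mem[OF column_basis_swap[OF basis]] by (rule g_period)
    ultimately show False
      using gE[of 0 4] by simp
  qed
  ultimately show ?thesis
    by (cases "chromatic_number (SACG M)") (auto simp: numeral_eq_enat)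
qed

lemma tomato_cage_normal_form:
  fixes M :: "int ^ 2 ^ 4"
  assumes basis: "column_basis M x y"
    and i: "distinct [i1, i2, i3, i4]"
    and x: "\<bar>x $ i1\<bar> = 1" "\<bar>x $ i2\<bar> = 1" "\<bar>x $ i3\<bar> = 1" "x $ i4 = 0" and y: "\<bar>y $ i4\<bar> = 1"
  obtains P :: "int ^ 4 ^ 4" and U :: "int ^ 2 ^ 2"
  where "signed_permutation_matrix P" "unimodular U"
    "P ** M ** U = vector [vector [1, x $ i1 * y $ i1], vector [1, x $ i2 * y $ i2],
                           vector [1, x $ i3 * y $ i3], vector [0, 1]]"
proof -
  obtain U where U: "unimodular U" and xU: "x = column 1 (M ** U)" and yU: "y = column 2 (M ** U)"
    using basis unfolding column_basis_iff_unimodular by blast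
  define \<sigma> :: "4 \<Rightarrow> 4" where "\<sigma> k = (if k = 1 then i1 else if k = 2 then i2 else if k = 3 then i3 else i4)" for k
  \<comment> \<open>Multiplying the first three rows by their own entry of \<open>x\<close> turns
    that entry into 1; the fourth row is normalized by its entry of \<open>y\<close>.\<close>
  define \<epsilon> :: "4 \<Rightarrow> int" where "\<epsilon> k = (if k = 4 then y $ i4 else x $ \<sigma> k)" for k
  define P :: "int ^ 4 ^ 4" where "P = (\<chi> k j. if j = \<sigma> k then \<epsilon> k else 0)"
  have \<sigma>: "\<sigma> 1 = i1" "\<sigma> 2 = i2" "\<sigma> 3 = i3" "\<sigma> 4 = i4"
    by (simp_all add: \<sigma>_def)
  have \<epsilon>: "\<epsilon> 1 = x $ i1" "\<epsilon> 2 = x $ i2" "\<epsilon> 3 = x $ i3" "\<epsilon> 4 = y $ i4"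
    by (simp_all add: \<epsilon>_def \<sigma>)
  have "\<forall>k. \<epsilon> k = 1 \<or> \<epsilon> k = - 1"
    unfolding forall_4 \<epsilon> using x y by linarith
  moreover have "inj \<sigma>"
  proof -
    have "\<forall>k l. \<sigma> k = \<sigma> l \<longrightarrow> k = l"
      unfolding forall_4 \<sigma> using i by auto
    then show ?thesis by (simp add: inj_def)
  qed
  ultimately have "signed_permutation_matrix P"
    unfolding P_def by (intro signed_permutationI) auto
  moreover have "P ** M ** U = vector [vector [1, x $ i1 * y $ i1], vector [1, x $ i2 * y $ i2],
                           vector [1, x $ i3 * y $ i3], vector [0, 1]]"
  proof -
    have 1: "(P ** M ** U) $ k $ 1 = \<epsilon> k * x $ \<sigma> k" and 2: "(P ** M ** U) $ k $ 2 = \<epsilon> k * y $ \<sigma> k" for k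
      unfolding P_def matrix_mul_assoc[symmetric] signed_permutation_mult xU yU column_def by simp_all
    have sq: "z * z = 1" if "\<bar>z\<bar> = 1" for z :: int
      using that by (auto simp: abs_if split: if_splits)
    show ?thesis
      by (simp add: vec_eq_iff forall_4 forall_2 1 2 \<sigma> \<epsilon> vector_def sq x y)
  qed
  ultimately show ?thesis
    using that U by blast
qed

theorem theorem1p2:
  fixes M :: "int ^ 2 ^ 4"
  assumes "\<not> bipartite (SACG M)"
    and "\<not> has_loop (SACG M)"
    and "\<forall>i. row i M \<noteq> 0"
  shows "(let exceptional =
            (\<exists>(P :: int ^ 4 ^ 4) (U :: int ^ 2 ^ 2) (a :: int) (b :: int) (c :: int).
               signed_permutation_matrix P \<and> unimodular U \<and> 3 dvd a + b + c \<and>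
               P ** M ** U = vector [vector [1, a],
                                     vector [1, b],
                                     vector [1, c],
                                     vector [0, 1]])
          in (exceptional \<longrightarrow> chromatic_number (SACG M) = 4) \<and>
             (\<not> exceptional \<longrightarrow> chromatic_number (SACG M) = 3) \<and>
             (chromatic_number (SACG M) = 4 \<longleftrightarrow> exceptional))"
proof -
  define exceptional where "exceptional \<longleftrightarrow>
    (\<exists>(P :: int ^ 4 ^ 4) (U :: int ^ 2 ^ 2) (a :: int) (b :: int) (c :: int).
       signed_permutation_matrix P \<and> unimodular U \<and> 3 dvd a + b + c \<and>
       P ** M ** U = vector [vector [1, a], vector [1, b], vector [1, c], vector [0, 1]])"
  have four: "chromatic_number (SACG M) = 4" if exceptional
    using that tomato_cage_chromatic_number[OF assms(2)] unfolding exceptional_def by blast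
  have three: "chromatic_number (SACG M) = 3" if "\<not> exceptional"
    using assms
  proof (cases rule: character_or_tomato_cage)
    case (coloring t)
    then have "chromatic_number (SACG M) \<le> enat 3"
      by (intro chromatic_number_le_by_character[of 3 t]) auto
    \<comment> \<open>Nonbipartiteness excludes the value 2, and smaller values are
      impossible.\<close>
    then show ?thesis
      using chromatic_number_SACG_ge_2[of M] assms(1) unfolding bipartite_def
      by (cases "chromatic_number (SACG M)") (auto simp: numeral_eq_enat)
  next
    case (tomato_cage x y i1 i2 i3 i4)
    obtain P :: "int ^ 4 ^ 4" and U :: "int ^ 2 ^ 2" where "signed_permutation_matrix P" "unimodular U"
      "P ** M ** U = vector [vector [1, x $ i1 * y $ i1], vector [1, x $ i2 * y $ i2],
                             vector [1, x $ i3 * y $ i3], vector [0, 1]]"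
      using tomato_cage_normal_form[OF tomato_cage(1,2,4-8)] .
    then have exceptional
      unfolding exceptional_def using tomato_cage(9) by blast
    then show ?thesis using that by blast
  qed
  have "(3 :: enat) \<noteq> 4"
    by simp
  then show ?thesis
    unfolding exceptional_def[symmetric] Let_def using four three by metis
qed

end
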